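(* For integers $r\ge1$ let $\kappa_n^{(r)}$ be the $r$-th order cumulant of the random variable $f_0(T_n)$. Then $$\kappa_n^{(r)}=\Bigg(\sum_{k=1}^{r}(-1)^{k-1}S(r,k)\,\frac{2^{k}\,(2k-2)!}{3^{2k-1}\,(k-1)!}\Bigg)\log n\,(1+o(1))$$ as $n\to\infty$, where $S(r,k)$ are the Stirling numbers of the second kind.
   Context: Let $T\subset\mathbb{R}^2$ be the triangle with vertices $(0,0)$, $\mathbf{v}_1=(1,0)$, $\mathbf{v}_2=(0,1)$. For $n\ge 0$ let $\mathbf{X}_1,\dots,\mathbf{X}_n$ be independent uniformly distributed random points in $T$ and $T_n:=\operatorname{conv}\{\mathbf{v}_1,\mathbf{v}_2,\mathbf{X}_1,\dots,\mathbf{X}_n\}$. $f_0(T_n)$ is the number of vertices of $T_n$ (including $\mathbf{v}_1,\mathbf{v}_2$). The $r$-th order cumulant of a random variable $X$ whose moment generating function is finite near $0$ is $\frac{d^r}{dt^r}\log\mathbb{E}e^{tX}\big|_{t=0}$. *)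

theory Defs
  imports
    "HOL-Probability.Probability"
    "HOL-Combinatorics.Stirling"
    "HOL-Library.Landau_Symbols"
begin

definition unit_triangle :: "(real \<times> real) set" where
  "unit_triangle = convex hull {(0, 0), (1, 0), (0, 1)}"

definition vertices :: "'a :: real_vector set \<Rightarrow> 'a set" where
  "vertices P = {v. v extreme_point_of P}"

definition f0 :: "'a :: real_vector set \<Rightarrow> nat" where
  "f0 P = card (vertices P)"

definition hull_polygon :: "nat \<Rightarrow> (nat \<Rightarrow> real \<times> real) \<Rightarrow> (real \<times> real) set" where
  "hull_polygon n x = convex hull ({(1, 0), (0, 1)} \<union> x ` {1..n})"

text \<open>
  The cumulant of order \<open>r\<close> is only meaningful if the moment generating function
  \<open>t \<mapsto> E exp (t Y)\<close> is finite near \<open>0\<close>.  This is automatic for bounded random variables, such as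
  the number of vertices of a hull of at most \<open>n + 2\<close> points.
\<close>

definition cumulant :: "nat \<Rightarrow> 'a measure \<Rightarrow> ('a \<Rightarrow> real) \<Rightarrow> real" where
  "cumulant r M Y = (deriv ^^ r) (\<lambda>t. ln (\<integral>\<omega>. exp (t * Y \<omega>) \<partial>M)) 0"

end

theory Submission
  imports Defs "HOL-Complex_Analysis.Complex_Analysis" "HOL-Real_Asymp.Real_Asymp"
begin

text \<open>
  Write \<open>v\<^sub>1 = (1, 0)\<close> and \<open>v\<^sub>2 = (0, 1)\<close>, and let \<open>g\<^sub>n(z)\<close> be the expectation of \<open>z\<close> to the
  number of vertices of the hull other than \<open>v\<^sub>1, v\<^sub>2\<close>.  The proof computes \<open>g\<^sub>n\<close> by a recursion and
  then reads the cumulants off from its growth near \<open>z = 1\<close>.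

  \<^emph>\<open>The recursion.\<close>  Among the \<open>n\<close> points let \<open>p\<close> be the one that is seen from \<open>v\<^sub>1\<close> under the smallest
  angle to the horizontal leg.  It is the vertex next to \<open>v\<^sub>1\<close>.  The line through \<open>v\<^sub>1\<close> and \<open>p\<close> meets the
  opposite leg of the triangle in a point \<open>w\<close>, and all other points lie in the triangle \<open>v\<^sub>1 v\<^sub>2 w\<close>.  Those in \<open>v\<^sub>1 v\<^sub>2 p\<close> are not
  vertices; those in \<open>p v\<^sub>2 w\<close> are again independent and uniform, and they continue the chain from \<open>p\<close> to \<open>v\<^sub>2\<close>
  exactly as the original points continue the chain from \<open>v\<^sub>1\<close> to \<open>v\<^sub>2\<close> (\<open>f0_hull_peel_first_vertex\<close>).  An
  affine map turns \<open>p v\<^sub>2 w\<close> back into the full triangle, so conditioning on \<open>p\<close> and on the number \<open>m\<close> of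
  points in \<open>p v\<^sub>2 w\<close> gives, after a Beta integral over \<open>p\<close>,
  \<open>n (n + 1) g\<^sub>n = 2 z \<Sum> (n - m) g\<^sub>m\<close>, the sum over \<open>m < n\<close> (\<open>vertex_pgf\<close>).

  \<^emph>\<open>The growth.\<close>  Second differences turn this into a three-term recursion, and
  \<open>g\<^sub>k\<^sub>+\<^sub>1 = g\<^sub>k (1 + b\<^sub>k / (k + 1))\<close> defines numbers \<open>b\<^sub>k\<close> that satisfy a first-order recursion.  For
  complex \<open>z\<close> in a fixed disc around 1 they stay below \<open>1/2\<close>, so that \<open>g\<^sub>n\<close> has no zero there, and they
  approach at speed \<open>O(1/k)\<close> the small root \<open>\<gamma> = (sqrt (1 + 8 z) - 3) / 2\<close> of \<open>\<gamma>\<^sup>2 + 3 \<gamma> = 2 (z - 1)\<close>.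
  Summing logarithms, \<open>log g\<^sub>n - \<gamma> log n\<close> is holomorphic and bounded on the disc uniformly in \<open>n\<close>
  (\<open>log_vertex_gf_near\<close>).

  \<^emph>\<open>The cumulants.\<close>  With \<open>z = exp t\<close>, Cauchy's inequality bounds all derivatives at \<open>t = 0\<close> of the
  difference, so the cumulant of order \<open>r\<close> is \<open>log n\<close> times the \<open>r\<close>-th derivative of
  \<open>(sqrt (1 + 8 exp t) - 3) / 2\<close> at 0, up to a bounded error (\<open>cumulant_near_ln\<close>).  Stirling numbers enter
  as the coefficients of repeated differentiation of a function of \<open>exp t\<close>.  Finally the derivative is not
  zero, which the asymptotic equivalence needs: the summand for \<open>k\<close> has 2-adic valuation at least
  \<open>2 k - 1\<close>, with equality for \<open>k = 1\<close> (\<open>cumulant_constant_nonzero\<close>).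
\<close>

section \<open>The vertex count of a convex hull and how its first vertex peels off\<close>

lemma vertices_convex_hull:
  fixes S :: "'a::euclidean_space set"
  assumes "finite S"
  shows "vertices (convex hull S) = {q \<in> S. q \<notin> convex hull (S - {q})}"
proof (intro set_eqI iffI)
  fix q assume "q \<in> vertices (convex hull S)"
  then have q: "q extreme_point_of (convex hull S)"
    by (simp add: vertices_def)
  then have qS: "q \<in> S"
    by (rule extreme_point_of_convex_hull)
  have "q \<notin> convex hull (S - {q})"
  proof
    assume "q \<in> convex hull (S - {q})"
    then have "convex hull (insert q (S - {q})) = convex hull (S - {q})"
      by (rule hull_redundant)
    then have "q extreme_point_of (convex hull (S - {q}))"
      using q qS by (simp add: insert_absorb)
    then show False
      using extreme_point_of_convex_hull by blast
  qed
  with qS show "q \<in> {q \<in> S. q \<notin> convex hull (S - {q})}" by simp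
next
  fix q assume "q \<in> {q \<in> S. q \<notin> convex hull (S - {q})}"
  then have "q \<in> S" "q \<notin> convex hull (S - {q})" by auto
  then show "q \<in> vertices (convex hull S)"
    using extreme_point_of_convex_hull_insert[of "S - {q}" q] assms
    by (simp add: vertices_def insert_absorb)
qed

text \<open>
  The linear functionals that strictly separate a point from a finite set form an open set, so a countable
  dense set of functionals suffices as witnesses.  This is what makes the vertex count measurable.
\<close>

lemma not_in_hull_iff_dense_functional:
  fixes S :: "'a::euclidean_space set"
  assumes "finite S" and D: "\<And>U. open U \<Longrightarrow> U \<noteq> {} \<Longrightarrow> \<exists>d\<in>D. d \<in> U"
  shows "q \<notin> convex hull S \<longleftrightarrow> (\<exists>a\<in>D. \<forall>s\<in>S. a \<bullet> q < a \<bullet> s)"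
proof
  assume q: "q \<notin> convex hull S"
  have "compact (convex hull S)"
    using assms by (simp add: finite_imp_compact_convex_hull)
  then obtain a b where ab: "a \<bullet> q < b" "\<And>x. x \<in> convex hull S \<Longrightarrow> a \<bullet> x > b"
    using separating_hyperplane_closed_point[of "convex hull S" q] q
    by (auto simp: compact_imp_closed)
  define U where "U = (\<Inter>s\<in>S. {a. a \<bullet> q < a \<bullet> s})"
  have "open U"
    unfolding U_def using assms(1) by (intro open_INT ballI open_Collect_less continuous_intros)
  moreover have "a \<in> U"
    using ab by (force simp: U_def intro: hull_inc)
  ultimately obtain d where "d \<in> D" "d \<in> U"
    using D[of U] by blast
  then show "\<exists>a\<in>D. \<forall>s\<in>S. a \<bullet> q < a \<bullet> s"
    by (auto simp: U_def)
next
  assume "\<exists>a\<in>D. \<forall>s\<in>S. a \<bullet> q < a \<bullet> s"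
  then obtain a where a: "\<And>s. s \<in> S \<Longrightarrow> a \<bullet> q < a \<bullet> s" by blast
  have "convex hull S \<subseteq> {x. a \<bullet> q < a \<bullet> x}"
    using a by (intro hull_minimal) (auto simp: convex_halfspace_gt)
  then show "q \<notin> convex hull S" by auto
qed

text \<open>
  The points are random and may coincide, so a vertex is counted at the first index where it occurs; the
  vertex count is then the number of indices with a measurable property.  The family is given as a set of
  functions, which also covers hulls with some fixed points.
\<close>

lemma measurable_f0_convex_hull:
  fixes F :: "('w \<Rightarrow> 'a::euclidean_space) set"
  assumes "finite F" and F: "\<And>y. y \<in> F \<Longrightarrow> y \<in> borel_measurable N"
  shows "(\<lambda>\<omega>. f0 (convex hull ((\<lambda>y. y \<omega>) ` F))) \<in> measurable N (count_space UNIV)"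
proof -
  obtain ys where ys: "set ys = F"
    using \<open>finite F\<close> finite_list by blast
  obtain D :: "'a set" where D: "countable D" "\<And>U. open U \<Longrightarrow> U \<noteq> {} \<Longrightarrow> \<exists>d\<in>D. d \<in> U"
    using countable_dense_exists by blast
  define n where "n = length ys"
  have [measurable]: "(ys ! i) \<in> borel_measurable N" if "i < n" for i
    using F ys that by (auto simp: n_def)
  define P where "P = (\<lambda>\<omega> i. (\<forall>k<i. (ys ! k) \<omega> \<noteq> (ys ! i) \<omega>) \<and>
      (\<exists>a\<in>D. \<forall>k<n. (ys ! k) \<omega> = (ys ! i) \<omega> \<or> a \<bullet> (ys ! i) \<omega> < a \<bullet> (ys ! k) \<omega>))"
  have eq: "f0 (convex hull ((\<lambda>y. y \<omega>) ` F)) = card {i\<in>{..<n}. P \<omega> i}" for \<omega>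
  proof -
    let ?S = "(\<lambda>y. y \<omega>) ` F"
    have S: "?S = (\<lambda>i. (ys ! i) \<omega>) ` {..<n}"
      unfolding ys[symmetric] n_def set_conv_nth by auto
    have fin: "finite ?S" using \<open>finite F\<close> by simp
    have vert: "q \<in> vertices (convex hull ?S) \<longleftrightarrow>
        q \<in> ?S \<and> (\<exists>a\<in>D. \<forall>k<n. (ys ! k) \<omega> = q \<or> a \<bullet> q < a \<bullet> (ys ! k) \<omega>)" for q
    proof -
      have "q \<notin> convex hull (?S - {q}) \<longleftrightarrow> (\<exists>a\<in>D. \<forall>s\<in>?S - {q}. a \<bullet> q < a \<bullet> s)"
        using fin D by (intro not_in_hull_iff_dense_functional) auto
      also have "\<dots> \<longleftrightarrow> (\<exists>a\<in>D. \<forall>k<n. (ys ! k) \<omega> = q \<or> a \<bullet> q < a \<bullet> (ys ! k) \<omega>)"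
        unfolding S by auto
      finally show ?thesis
        unfolding vertices_convex_hull[OF fin] by auto
    qed
    have "bij_betw (\<lambda>i. (ys ! i) \<omega>) {i\<in>{..<n}. P \<omega> i} (vertices (convex hull ?S))"
      unfolding bij_betw_def
    proof (intro conjI inj_onI set_eqI iffI)
      fix i j assume "i \<in> {i\<in>{..<n}. P \<omega> i}" "j \<in> {i\<in>{..<n}. P \<omega> i}" "(ys ! i) \<omega> = (ys ! j) \<omega>"
      then show "i = j"
        unfolding P_def by (cases i j rule: linorder_cases) auto
    next
      fix q assume "q \<in> (\<lambda>i. (ys ! i) \<omega>) ` {i\<in>{..<n}. P \<omega> i}"
      then obtain i where i: "i < n" "P \<omega> i" "q = (ys ! i) \<omega>" by auto
      then have "q \<in> ?S" unfolding S by blast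
      with i show "q \<in> vertices (convex hull ?S)"
        unfolding vert by (simp add: P_def)
    next
      fix q assume q: "q \<in> vertices (convex hull ?S)"
      then have "q \<in> ?S" unfolding vert by blast
      then obtain i0 where i0: "i0 < n" "(ys ! i0) \<omega> = q"
        unfolding S by blast
      define i where "i = (LEAST i. i < n \<and> (ys ! i) \<omega> = q)"
      have i: "i < n \<and> (ys ! i) \<omega> = q"
        unfolding i_def using LeastI[of "\<lambda>i. i < n \<and> (ys ! i) \<omega> = q" i0] i0 by blast
      have "(ys ! k) \<omega> \<noteq> q" if "k < i" for k
        using not_less_Least[of k "\<lambda>i. i < n \<and> (ys ! i) \<omega> = q", folded i_def] that i
        by simp
      moreover have "\<exists>a\<in>D. \<forall>k<n. (ys ! k) \<omega> = q \<or> a \<bullet> q < a \<bullet> (ys ! k) \<omega>"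
        using q unfolding vert by blast
      ultimately have "P \<omega> i"
        using i by (simp add: P_def)
      with i show "q \<in> (\<lambda>i. (ys ! i) \<omega>) ` {i\<in>{..<n}. P \<omega> i}"
        by (intro image_eqI[of _ _ i]) auto
    qed
    then show ?thesis
      unfolding f0_def by (simp add: bij_betw_same_card)
  qed
  have [measurable]: "Measurable.pred N (\<lambda>\<omega>. P \<omega> i)" if "i < n" for i
  proof -
    have "Measurable.pred N (\<lambda>\<omega>. (ys ! k) \<omega> = (ys ! i) \<omega>)" if "k < n" for k
      using that \<open>i < n\<close> by measurable
    moreover have "Measurable.pred N (\<lambda>\<omega>. a \<bullet> (ys ! i) \<omega> < a \<bullet> (ys ! k) \<omega>)" if "k < n" for k a
      using that \<open>i < n\<close> by measurable
    ultimately have m: "Measurable.pred N (\<lambda>\<omega>. \<forall>k\<in>{..<i}. (ys ! k) \<omega> \<noteq> (ys ! i) \<omega>)"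
      "Measurable.pred N (\<lambda>\<omega>. \<forall>k\<in>{..<n}. (ys ! k) \<omega> = (ys ! i) \<omega> \<or> a \<bullet> (ys ! i) \<omega> < a \<bullet> (ys ! k) \<omega>)" for a
      using that by (auto intro!: pred_intros_finite pred_intros_logic)
    have "Measurable.pred N (\<lambda>\<omega>.
        \<exists>a\<in>D. \<forall>k\<in>{..<n}. (ys ! k) \<omega> = (ys ! i) \<omega> \<or> a \<bullet> (ys ! i) \<omega> < a \<bullet> (ys ! k) \<omega>)"
      using m(2) D(1) unfolding pred_def by (intro sets.sets_Collect_countable_Ex') auto
    from pred_intros_logic(3)[OF m(1) this] show ?thesis
      unfolding P_def Ball_def Bex_def lessThan_iff .
  qed
  show ?thesis
    unfolding eq by (rule measurable_card) (auto simp: pred_def[symmetric])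
qed

lemma f0_convex_hull_affine_image:
  fixes L :: "'a::euclidean_space \<Rightarrow> 'b::euclidean_space"
  assumes "linear L" "inj L"
  shows "f0 (convex hull ((\<lambda>x. c + L x) ` S)) = f0 (convex hull S)"
proof -
  have "(\<lambda>x. c + L x) ` S = (+) c ` L ` S"
    by (simp add: image_image)
  then have hull: "convex hull ((\<lambda>x. c + L x) ` S) = (+) c ` L ` (convex hull S)"
    by (simp only: convex_hull_translation convex_hull_linear_image[OF assms(1)])
  \<comment> \<open>extreme points are the singleton faces, and injective linear maps preserve faces\<close>
  have ext: "L x extreme_point_of L ` A \<longleftrightarrow> x extreme_point_of A" for x A
    using face_of_linear_image[OF assms, of "{x}" A] by (simp add: face_of_singleton)
  have "{x. x extreme_point_of L ` A} = L ` {x. x extreme_point_of A}" for A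
  proof (intro set_eqI iffI)
    fix y assume y: "y \<in> {x. x extreme_point_of L ` A}"
    then obtain x where "y = L x"
      by (auto simp: extreme_point_of_def)
    with y show "y \<in> L ` {x. x extreme_point_of A}"
      using ext by blast
  qed (use ext in blast)
  then have "vertices (convex hull ((\<lambda>x. c + L x) ` S)) = (\<lambda>x. c + L x) ` vertices (convex hull S)"
    unfolding vertices_def hull extreme_points_of_translation by (simp add: image_image)
  moreover have "inj_on (\<lambda>x. c + L x) A" for A
    using assms(2) by (auto simp: inj_on_def)
  ultimately show ?thesis
    unfolding f0_def by (simp add: card_image)
qed

text \<open>
  Twice the signed areas of the triangles \<open>v\<^sub>1 q p\<close> and \<open>q v\<^sub>2 p\<close> for \<open>v\<^sub>1 = (1, 0)\<close> and \<open>v\<^sub>2 = (0, 1)\<close>.  For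
  \<open>p\<close> inside the triangle, a point \<open>q\<close> with \<open>side1 p q > 0\<close> is seen from \<open>v\<^sub>1\<close> under a larger angle than \<open>p\<close>;
  \<open>side2 p q\<close> is positive exactly on the side of \<open>v\<^sub>1\<close> of the line through \<open>p\<close> and \<open>v\<^sub>2\<close>.
\<close>

definition side1 :: "real \<times> real \<Rightarrow> real \<times> real \<Rightarrow> real" where
  "side1 p q = snd q * (1 - fst p) - snd p * (1 - fst q)"

definition side2 :: "real \<times> real \<Rightarrow> real \<times> real \<Rightarrow> real" where
  "side2 p q = fst q * (1 - snd p) - fst p * (1 - snd q)"

definition open_triangle :: "(real \<times> real) set" where
  "open_triangle = {q. 0 < fst q \<and> 0 < snd q \<and> fst q + snd q < 1}"

lemma side_affine:
  assumes "u + v = 1"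
  shows "side1 p (u *\<^sub>R q + v *\<^sub>R s) = u * side1 p q + v * side1 p s"
    and "side2 p (u *\<^sub>R q + v *\<^sub>R s) = u * side2 p q + v * side2 p s"
proof -
  have v: "v = 1 - u" using assms by simp
  show "side1 p (u *\<^sub>R q + v *\<^sub>R s) = u * side1 p q + v * side1 p s"
    "side2 p (u *\<^sub>R q + v *\<^sub>R s) = u * side2 p q + v * side2 p s"
    unfolding side1_def side2_def v by (simp_all add: algebra_simps)
qed

text \<open>
  The barycentric coordinates of \<open>q\<close> in the triangle are \<open>side2 p q\<close>, \<open>side1 p q\<close> and
  \<open>1 - fst q - snd q\<close>, divided by the value \<open>1 - fst p - snd p\<close> of their sum.
\<close>

lemma in_hull_corner_triangle:
  assumes p: "p \<in> open_triangle"
    and q: "side1 p q \<ge> 0" "side2 p q \<ge> 0" "fst q + snd q \<le> 1"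
  shows "q \<in> convex hull {(1, 0), (0, 1), p}"
proof -
  obtain a b x y where pq: "p = (a, b)" "q = (x, y)" by (cases p, cases q)
  define D where "D = 1 - a - b"
  have D: "D > 0" using p by (simp add: open_triangle_def pq D_def)
  have 1: "side2 p q / D + side1 p q / D + (1 - x - y) / D = 1"
    using D by (simp add: side1_def side2_def pq divide_simps) (simp add: D_def algebra_simps)
  have 2: "q = (side2 p q / D) *\<^sub>R (1, 0) + (side1 p q / D) *\<^sub>R (0, 1) + ((1 - x - y) / D) *\<^sub>R p"
    using D by (simp add: side1_def side2_def pq divide_simps) (simp add: D_def algebra_simps)
  have "\<exists>u v w. 0 \<le> u \<and> 0 \<le> v \<and> 0 \<le> w \<and> u + v + w = 1 \<and> q = u *\<^sub>R (1, 0) + v *\<^sub>R (0, 1) + w *\<^sub>R p"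
    using 1 2 D q by (intro exI[of _ "side2 p q / D"] exI[of _ "side1 p q / D"] exI[of _ "(1 - x - y) / D"])
      (simp add: pq)
  then show ?thesis
    unfolding convex_hull_3 by blast
qed

text \<open>
  The case of a vanishing first barycentric coordinate.
\<close>

lemma in_hull_chord:
  assumes p: "p \<in> open_triangle"
    and q: "side1 p q \<ge> 0" "side2 p q = 0" "fst q + snd q \<le> 1"
  shows "q \<in> convex hull {p, (0, 1)}"
proof -
  obtain a b x y where pq: "p = (a, b)" "q = (x, y)" by (cases p, cases q)
  define D where "D = 1 - a - b"
  have D: "D > 0" using p by (simp add: open_triangle_def pq D_def)
  have s2: "x * (1 - b) = a * (1 - y)" using q by (simp add: side2_def pq)
  have b: "1 - b > 0" "a > 0" using p by (auto simp: open_triangle_def pq)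
  have 1: "(1 - x - y) / D + side1 p q / D = 1"
    using D s2 by (simp add: side1_def side2_def pq divide_simps) (simp add: D_def algebra_simps)
  have 2: "q = ((1 - x - y) / D) *\<^sub>R p + (side1 p q / D) *\<^sub>R (0, 1)"
    using D s2 by (simp add: side1_def side2_def pq divide_simps) (simp add: D_def algebra_simps)
  have "\<exists>u v. 0 \<le> u \<and> 0 \<le> v \<and> u + v = 1 \<and> q = u *\<^sub>R p + v *\<^sub>R (0, 1)"
    using 1 2 D q by (intro exI[of _ "side1 p q / D"] exI[of _ "(1 - x - y) / D"])
      (simp add: pq)
  then show ?thesis
    unfolding convex_hull_2 by blast
qed

text \<open>
  The geometric core of the recursion.  Removing \<open>v\<^sub>1 = (1, 0)\<close>, which is a vertex, loses no other vertex
  and creates none.  Supporting lines show that \<open>v\<^sub>1\<close>, \<open>v\<^sub>2 = (0, 1)\<close> and \<open>p\<close> are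
  vertices.  The points on the near side of the line \<open>p v\<^sub>2\<close> lie in the triangle \<open>v\<^sub>1 v\<^sub>2 p\<close> and
  can be dropped.  A far point \<open>q\<close> that is a convex combination of \<open>v\<^sub>1\<close> and a point \<open>s\<close> of the remaining hull is
  also one of \<open>s\<close> and the point where the segment from \<open>v\<^sub>1\<close> to \<open>q\<close> crosses the chord from \<open>p\<close> to \<open>v\<^sub>2\<close>, so
  \<open>v\<^sub>1\<close> was not needed to represent \<open>q\<close>.
\<close>

lemma f0_hull_peel_first_vertex:
  assumes p: "p \<in> open_triangle" and "finite X"
    and X: "\<And>q. q \<in> X \<Longrightarrow> q \<in> open_triangle \<and> side1 p q > 0"
  shows "f0 (convex hull ({(1, 0), (0, 1), p} \<union> X)) =
         Suc (f0 (convex hull ({p, (0, 1)} \<union> {q \<in> X. side2 p q < 0})))"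
proof -
  define S where "S = {p, (0, 1)} \<union> {q \<in> X. side2 p q < 0}"
  let ?v1 = "(1, 0) :: real \<times> real" and ?v2 = "(0, 1) :: real \<times> real"
  have fin: "finite S" using \<open>finite X\<close> by (simp add: S_def)
  have subT: "S \<subseteq> insert ?v2 open_triangle"
    using p X by (auto simp: S_def)
  have v1S: "?v1 \<notin> S"
    using subsetD[OF subT, of ?v1] by (auto simp: open_triangle_def)
  have v2S: "?v2 \<in> S" by (simp add: S_def)
  have pv: "p \<noteq> ?v2" "side1 p p = 0" "side2 p p = 0" "side2 p ?v2 = 0" "side1 p ?v2 > 0" "side1 p ?v1 = 0"
    "side2 p ?v1 > 0"
    using p by (auto simp: open_triangle_def side1_def side2_def)
  have "convex hull ({?v1, ?v2, p} \<union> X) = convex hull (insert ?v1 S)"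
  proof
    have "X \<subseteq> convex hull (insert ?v1 S)"
    proof
      fix q assume q: "q \<in> X"
      show "q \<in> convex hull (insert ?v1 S)"
      proof (cases "side2 p q < 0")
        case True
        with q show ?thesis by (intro hull_inc) (auto simp: S_def)
      next
        case False
        then have "q \<in> convex hull {?v1, ?v2, p}"
          using X[OF q] p by (intro in_hull_corner_triangle) (auto simp: open_triangle_def)
        then show ?thesis
          using hull_mono[of "{?v1, ?v2, p}" "insert ?v1 S" convex] by (auto simp: S_def)
      qed
    qed
    moreover have "{?v1, ?v2, p} \<subseteq> convex hull (insert ?v1 S)"
      using hull_subset[of "insert ?v1 S" convex] by (auto simp: S_def)
    ultimately show "convex hull ({?v1, ?v2, p} \<union> X) \<subseteq> convex hull (insert ?v1 S)"
      by (intro hull_minimal) auto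
  qed (auto intro!: hull_mono simp: S_def)
  moreover have "vertices (convex hull (insert ?v1 S)) = insert ?v1 (vertices (convex hull S))"
  proof -
    have v1: "?v1 \<notin> convex hull S"
    proof -
      have "convex hull S \<subseteq> {x. (1, 0) \<bullet> x < 1}"
        using subT by (intro hull_minimal) (auto simp: convex_halfspace_lt open_triangle_def)
      then show ?thesis by auto
    qed
    have key: "q \<in> convex hull (S - {q})" if qS: "q \<in> S" and q: "q \<in> convex hull (insert ?v1 (S - {q}))" for q
    proof -
      consider "q = ?v2" | "q = p" | "q \<in> X" "side2 p q < 0" "q \<noteq> p" "q \<noteq> ?v2"
        using qS pv by (auto simp: S_def)
      then show ?thesis
      proof cases
        case 1
        have "convex hull (insert ?v1 (S - {q})) \<subseteq> {x. (0, 1) \<bullet> x < 1}"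
          using subT by (intro hull_minimal) (auto simp: convex_halfspace_lt open_triangle_def 1)
        then show ?thesis using q 1 by auto
      next
        case 2
        have ps: "side1 p s > 0" if "s \<in> S - {p}" for s
          using that X[of s] pv by (auto simp: S_def)
        obtain u v s where uvs: "0 \<le> u" "0 \<le> v" "u + v = 1" "s \<in> convex hull (S - {p})"
          "p = u *\<^sub>R ?v1 + v *\<^sub>R s"
          using q convex_hull_insert[of "S - {p}" ?v1] v2S pv(1) unfolding 2 by blast
        have "convex {x. side1 p x > 0}"
          unfolding convex_def by (auto simp: side_affine(1)) (smt (verit) mult_nonneg_nonneg mult_pos_pos)
        then have "convex hull (S - {p}) \<subseteq> {x. side1 p x > 0}"
          using ps by (intro hull_minimal) auto
        then have s: "side1 p s > 0" using uvs by auto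
        have "v * side1 p s = 0"
          using side_affine(1)[OF uvs(3), of p ?v1 s] pv unfolding uvs(5)[symmetric] by simp
        then have "p = ?v1" using s uvs by simp
        then show ?thesis using p by (simp add: open_triangle_def)
      next
        case 3
        obtain u v s where uvs: "0 \<le> u" "0 \<le> v" "u + v = 1" "s \<in> convex hull (S - {q})"
          "q = u *\<^sub>R ?v1 + v *\<^sub>R s"
          using q convex_hull_insert[of "S - {q}" ?v1] v2S 3(4) by blast
        \<comment> \<open>the parameter at which the segment from \<open>?v1\<close> to \<open>q\<close> crosses the line through \<open>p\<close> and \<open>?v2\<close>\<close>
        define \<tau> where "\<tau> = side2 p ?v1 / (side2 p ?v1 - side2 p q)"
        have \<tau>: "0 < \<tau>" "\<tau> < 1"
          using pv 3 by (auto simp: \<tau>_def divide_simps)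
        define r where "r = (1 - \<tau>) *\<^sub>R ?v1 + \<tau> *\<^sub>R q"
        have sq: "side1 p q > 0" "fst q + snd q < 1"
          using X[OF 3(1)] by (auto simp: open_triangle_def)
        have "side2 p r = 0"
        proof -
          have "\<tau> * (side2 p ?v1 - side2 p q) = side2 p ?v1"
            using pv 3 by (simp add: \<tau>_def)
          then show ?thesis
            unfolding r_def by (subst side_affine(2)) (simp_all add: algebra_simps)
        qed
        moreover have "side1 p r \<ge> 0"
          unfolding r_def using pv sq \<tau> by (subst side_affine(1)) auto
        moreover have "fst r + snd r \<le> 1"
        proof -
          have "fst r + snd r = (1 - \<tau>) + \<tau> * (fst q + snd q)"
            by (simp add: r_def algebra_simps)
          also have "\<dots> \<le> (1 - \<tau>) + \<tau> * 1"
            using sq \<tau> by (intro add_left_mono mult_left_mono) auto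
          finally show ?thesis by simp
        qed
        ultimately have "r \<in> convex hull {p, ?v2}"
          by (intro in_hull_chord p)
        then have r: "r \<in> convex hull (S - {q})"
          using hull_mono[of "{p, ?v2}" "S - {q}" convex] 3 by (auto simp: S_def)
        define w where "w = 1 - \<tau> + u * \<tau>"
        have w: "w > 0" using \<tau> uvs by (simp add: w_def add_pos_nonneg)
        have "w *\<^sub>R q = u *\<^sub>R r + ((1 - \<tau>) * v) *\<^sub>R s"
        proof -
          have "u *\<^sub>R r + ((1 - \<tau>) * v) *\<^sub>R s = (1 - \<tau>) *\<^sub>R (u *\<^sub>R ?v1 + v *\<^sub>R s) + (u * \<tau>) *\<^sub>R q"
            unfolding r_def by (simp only: scaleR_add_right scaleR_scaleR ac_simps)
          also have "\<dots> = w *\<^sub>R q"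
            unfolding uvs(5)[symmetric] w_def by (simp add: scaleR_add_left)
          finally show ?thesis ..
        qed
        then have "inverse w *\<^sub>R (w *\<^sub>R q) = (u / w) *\<^sub>R r + ((1 - \<tau>) * v / w) *\<^sub>R s"
          by (simp only: scaleR_add_right scaleR_scaleR divide_inverse mult.commute)
        then have "q = (u / w) *\<^sub>R r + ((1 - \<tau>) * v / w) *\<^sub>R s"
          using w by simp
        moreover have "u / w + (1 - \<tau>) * v / w = 1"
        proof -
          have v: "v = 1 - u" using uvs by simp
          show ?thesis
            using w unfolding add_divide_distrib[symmetric] v
            by (simp add: w_def algebra_simps)
        qed
        ultimately show ?thesis
          using r uvs w \<tau> convexD[OF convex_convex_hull r uvs(4), of "u / w" "(1 - \<tau>) * v / w"] by auto
      qed
    qed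
    have mono: "q \<in> convex hull (insert ?v1 (S - {q}))" if "q \<in> convex hull (S - {q})" for q
      using that hull_mono[of "S - {q}" "insert ?v1 (S - {q})" convex] by auto
    have ins: "insert ?v1 S - {q} = (if q = ?v1 then S else insert ?v1 (S - {q}))" for q
      using v1S by auto
    show ?thesis
      unfolding vertices_convex_hull[OF fin] vertices_convex_hull[OF finite.insertI[OF fin]]
      using key mono v1 v1S by (auto simp: ins split: if_splits)
  qed
  moreover have "?v1 \<notin> vertices (convex hull S)" "finite (vertices (convex hull S))"
    using v1S fin by (auto simp: vertices_convex_hull[OF fin])
  ultimately show ?thesis
    unfolding S_def[symmetric] f0_def by simp
qed

section \<open>Integrals over the triangle\<close>

lemma nn_integral_lborel_prod:
  fixes h :: "real \<times> real \<Rightarrow> ennreal"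
  assumes [measurable]: "h \<in> borel_measurable borel"
  shows "(\<integral>\<^sup>+q. h q \<partial>lborel) = (\<integral>\<^sup>+x. \<integral>\<^sup>+y. h (x, y) \<partial>lborel \<partial>lborel)"
  unfolding lborel_prod[symmetric] by (rule lborel.nn_integral_fst[symmetric]) (simp add: lborel_prod)

text \<open>
  For triangular affine maps the change of variables reduces to two one-dimensional ones.  All affine maps
  below are of this form because they preserve the vertical direction.
\<close>

lemma nn_integral_triangular_change:
  fixes h :: "real \<times> real \<Rightarrow> ennreal"
  assumes [measurable]: "h \<in> borel_measurable borel" and c: "c > 0" "d > 0"
  shows "(\<integral>\<^sup>+q. h q \<partial>lborel) =
    ennreal (c * d) * (\<integral>\<^sup>+q. h (c * fst q, e + f * fst q + d * snd q) \<partial>lborel)"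
proof -
  have m: "(\<lambda>q. h (c * fst q, e + f * fst q + d * snd q)) \<in> borel_measurable borel"
    by (rule measurable_compose[of _ _ borel]) (intro borel_measurable_continuous_onI continuous_intros, fact)
  have [measurable]: "h \<in> borel_measurable (borel \<Otimes>\<^sub>M borel)"
    by (simp add: borel_prod)
  have "(\<integral>\<^sup>+q. h q \<partial>lborel) = (\<integral>\<^sup>+x. \<integral>\<^sup>+y. h (x, y) \<partial>lborel \<partial>lborel)"
    by (rule nn_integral_lborel_prod) fact
  also have "\<dots> = ennreal c * (\<integral>\<^sup>+x. \<integral>\<^sup>+y. h (c * x, y) \<partial>lborel \<partial>lborel)"
    using c by (subst nn_integral_real_affine[of _ c 0]) auto
  also have "(\<lambda>x. \<integral>\<^sup>+y. h (c * x, y) \<partial>lborel) = (\<lambda>x. ennreal d * (\<integral>\<^sup>+y. h (c * x, e + f * x + d * y) \<partial>lborel))"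
  proof
    fix x
    show "(\<integral>\<^sup>+y. h (c * x, y) \<partial>lborel) = ennreal d * (\<integral>\<^sup>+y. h (c * x, e + f * x + d * y) \<partial>lborel)"
      using c by (subst nn_integral_real_affine[of _ d "e + f * x"]) auto
  qed
  also have "(\<integral>\<^sup>+x. ennreal d * (\<integral>\<^sup>+y. h (c * x, e + f * x + d * y) \<partial>lborel) \<partial>lborel) =
      ennreal d * (\<integral>\<^sup>+x. (\<integral>\<^sup>+y. h (c * x, e + f * x + d * y) \<partial>lborel) \<partial>lborel)"
    by (intro nn_integral_cmult) measurable
  also have "(\<integral>\<^sup>+x. (\<integral>\<^sup>+y. h (c * x, e + f * x + d * y) \<partial>lborel) \<partial>lborel) =
      (\<integral>\<^sup>+q. h (c * fst q, e + f * fst q + d * snd q) \<partial>lborel)"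
    using nn_integral_lborel_prod[OF m] by simp
  finally show ?thesis
    using c by (simp add: ennreal_mult mult.assoc)
qed

lemma measurable_open_triangle [measurable]: "open_triangle \<in> sets borel"
  unfolding open_triangle_def
  by (intro borel_open open_Collect_conj open_Collect_less continuous_intros)

lemma nn_integral_power_up_to:
  fixes c :: real
  assumes "c > 0"
  shows "(\<integral>\<^sup>+y. ennreal ((c - y) ^ N) * indicator {0<..<c} y \<partial>lborel) = ennreal (c ^ Suc N / real (Suc N))"
proof -
  have "AE y in lborel. ennreal ((c - y) ^ N) * indicator {0<..<c} y = ennreal ((c - y) ^ N) * indicator {0..c} y"
    using AE_lborel_singleton[of 0] AE_lborel_singleton[of c]
    by eventually_elim (auto simp: indicator_def)
  then have "(\<integral>\<^sup>+y. ennreal ((c - y) ^ N) * indicator {0<..<c} y \<partial>lborel) =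
        (\<integral>\<^sup>+y. ennreal ((c - y) ^ N) * indicator {0..c} y \<partial>lborel)"
    by (rule nn_integral_cong_AE)
  also have "\<dots> = ennreal (- ((c - c) ^ Suc N / real (Suc N)) - (- ((c - 0) ^ Suc N / real (Suc N))))"
  proof (rule nn_integral_FTC_Icc[where F = "\<lambda>y. - ((c - y) ^ Suc N / real (Suc N))"])
    fix y assume "y \<in> {0..c}"
    show "((\<lambda>y. - ((c - y) ^ Suc N / real (Suc N))) has_real_derivative (c - y) ^ N) (at y)"
      by (auto intro!: derivative_eq_intros simp del: power_Suc simp: divide_simps)
  qed (use assms in auto)
  finally show ?thesis by simp
qed

lemma nn_integral_Beta_nat:
  "(\<integral>\<^sup>+x. ennreal (x ^ m * (1 - x) ^ k) * indicator {0<..<1} x \<partial>lborel) =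
   ennreal (fact m * fact k / fact (m + k + 1))"
proof -
  have 1: "((\<lambda>t. t powr (real (Suc m) - 1) * (1 - t) powr (real (Suc k) - 1)) has_integral
      Beta (real (Suc m)) (real (Suc k))) {0..1}"
    by (intro has_integral_Beta_real) auto
  have 2: "((\<lambda>t. t ^ m * (1 - t) ^ k) has_integral Beta (real (Suc m)) (real (Suc k))) {0<..<1::real}"
    using 1 unfolding has_integral_Icc_iff_Ioo
    by (rule has_integral_eq[rotated]) (auto simp: powr_realpow)
  have "Beta (real (Suc m)) (real (Suc k)) = fact m * fact k / fact (m + k + 1)"
    unfolding Beta_def using Gamma_fact[of m, where 'a = real] Gamma_fact[of k, where 'a = real]
      Gamma_fact[of "m + k + 1", where 'a = real]
    by (simp add: algebra_simps)
  with 2 have 3: "((\<lambda>t. t ^ m * (1 - t) ^ k) has_integral fact m * fact k / fact (m + k + 1)) {0<..<1::real}"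
    by simp
  have "(\<integral>\<^sup>+x. ennreal ((x ^ m * (1 - x) ^ k) * indicator {0<..<1} x) \<partial>lborel) =
      ennreal (fact m * fact k / fact (m + k + 1))"
  proof (rule nn_integral_has_integral_lborel)
    show "((\<lambda>x. (x ^ m * (1 - x) ^ k) * indicator {0<..<1} x) has_integral fact m * fact k / fact (m + k + 1)) (UNIV :: real set)"
      using has_integral_restrict_UNIV[THEN iffD2, OF 3]
      by (rule has_integral_eq[rotated]) (simp add: indicator_def)
  qed (auto simp: indicator_def)
  also have "(\<lambda>x. ennreal ((x ^ m * (1 - x) ^ k) * indicator {0<..<1} x)) =
    (\<lambda>x::real. ennreal (x ^ m * (1 - x) ^ k) * indicator {0<..<1} x)"
    by (auto simp: indicator_def)
  finally show ?thesis .
qed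

text \<open>
  The quotient \<open>x (1 - x - y) / (1 - x)\<close> is the area, relative to the whole triangle, of the triangle that the
  first vertex \<open>(x, y)\<close> leaves to the points beyond it, and \<open>1 - x - y\<close> is the relative area of the
  triangle whose points it hides.
\<close>

lemma nn_integral_open_triangle_powers:
  "(\<integral>\<^sup>+q. ennreal ((1 - fst q - snd q) ^ k * (fst q * (1 - fst q - snd q) / (1 - fst q)) ^ m) *
      indicator open_triangle q \<partial>lborel) =
   ennreal (fact m * fact (Suc k) / (real (k + m + 1) * fact (k + m + 2)))"
proof -
  have [measurable]: "open_triangle \<in> sets (borel \<Otimes>\<^sub>M borel)"
    unfolding borel_prod by (rule measurable_open_triangle)
  have "(\<integral>\<^sup>+q. ennreal ((1 - fst q - snd q) ^ k * (fst q * (1 - fst q - snd q) / (1 - fst q)) ^ m) *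
      indicator open_triangle q \<partial>lborel) =
    (\<integral>\<^sup>+x. \<integral>\<^sup>+y. ennreal ((1 - x - y) ^ k * (x * (1 - x - y) / (1 - x)) ^ m) *
      indicator open_triangle (x, y) \<partial>lborel \<partial>lborel)"
    by (subst nn_integral_lborel_prod) (simp_all add: borel_prod[symmetric])
  also have "\<dots> = (\<integral>\<^sup>+x. ennreal (1 / real (k + m + 1)) *
      (ennreal (x ^ m * (1 - x) ^ Suc k) * indicator {0<..<1} x) \<partial>lborel)"
  proof (rule nn_integral_cong)
    fix x :: real
    show "(\<integral>\<^sup>+y. ennreal ((1 - x - y) ^ k * (x * (1 - x - y) / (1 - x)) ^ m) *
        indicator open_triangle (x, y) \<partial>lborel) = ennreal (1 / real (k + m + 1)) *
        (ennreal (x ^ m * (1 - x) ^ Suc k) * indicator {0<..<1} x)"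
    proof (cases "0 < x \<and> x < 1")
      case True
      have "(\<integral>\<^sup>+y. ennreal ((1 - x - y) ^ k * (x * (1 - x - y) / (1 - x)) ^ m) *
          indicator open_triangle (x, y) \<partial>lborel) =
        (\<integral>\<^sup>+y. ennreal ((x / (1 - x)) ^ m) * (ennreal (((1 - x) - y) ^ (k + m)) * indicator {0<..<1 - x} y) \<partial>lborel)"
        using True by (intro nn_integral_cong)
          (auto simp: indicator_def open_triangle_def power_add power_mult_distrib power_divide
             ennreal_mult'[symmetric])
      also have "\<dots> = ennreal ((x / (1 - x)) ^ m) * ennreal ((1 - x) ^ Suc (k + m) / real (Suc (k + m)))"
        using True by (subst nn_integral_cmult) (auto simp: nn_integral_power_up_to)
      also have "\<dots> = ennreal (1 / real (k + m + 1) * (x ^ m * (1 - x) ^ Suc k))"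
      proof -
        have "(x / (1 - x)) ^ m * ((1 - x) ^ Suc (k + m) / real (Suc (k + m))) =
            x ^ m * ((1 - x) ^ Suc k * (1 - x) ^ m / (1 - x) ^ m) / real (k + m + 1)"
          by (simp add: power_add power_divide mult_ac)
        then show ?thesis
          using True by (subst ennreal_mult'[symmetric]) auto
      qed
      finally show ?thesis
        using True by (subst (asm) ennreal_mult') auto
    next
      case False
      then have "indicator open_triangle (x, y) = (0 :: ennreal)" for y
        by (auto simp: open_triangle_def indicator_def)
      then show ?thesis
        using False by simp
    qed
  qed
  also have "\<dots> = ennreal (1 / real (k + m + 1)) * ennreal (fact m * fact (Suc k) / fact (m + Suc k + 1))"
    by (subst nn_integral_cmult) (measurable, simp only: nn_integral_Beta_nat)
  also have "\<dots> = ennreal (fact m * fact (Suc k) / (real (k + m + 1) * fact (k + m + 2)))"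
    by (subst ennreal_mult'[symmetric]) (simp_all add: add.commute mult.commute)
  finally show ?thesis .
qed

lemma emeasure_open_triangle: "emeasure lborel open_triangle = ennreal (1 / 2)"
  using nn_integral_open_triangle_powers[of 0 0] by simp

text \<open>
  The uniform distribution on the open triangle differs from the one on the closed triangle by a null set
  only.  With the open triangle the affine changes of variables below are exact, without boundary terms.
\<close>

definition triangle_measure :: "(real \<times> real) measure" where
  "triangle_measure = uniform_measure lborel open_triangle"

lemma sets_triangle_measure [measurable_cong, simp]: "sets triangle_measure = sets borel"
  by (simp add: triangle_measure_def)

lemma space_triangle_measure [simp]: "space triangle_measure = UNIV"
  by (simp add: triangle_measure_def)

lemma prob_space_triangle_measure: "prob_space triangle_measure"
  unfolding triangle_measure_def
  by (rule prob_space_uniform_measure) (auto simp: emeasure_open_triangle)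

lemma nn_integral_triangle_measure:
  assumes [measurable]: "h \<in> borel_measurable borel"
  shows "(\<integral>\<^sup>+q. h q \<partial>triangle_measure) = 2 * (\<integral>\<^sup>+q. h q * indicator open_triangle q \<partial>lborel)"
proof -
  have "inverse (ennreal (1 / 2)) = 2"
    by (subst inverse_ennreal) auto
  then show ?thesis
    unfolding triangle_measure_def
    by (subst nn_integral_uniform_measure)
      (auto simp only: emeasure_open_triangle divide_ennreal_def mult.commute assms measurable_lborel1
        measurable_open_triangle sets_lborel measurable_lborel2)
qed

lemma AE_triangle_measure: "AE q in triangle_measure. q \<in> open_triangle"
  unfolding triangle_measure_def
  by (rule AE_uniform_measureI) auto

text \<open>
  The affine map that sends \<open>(0, 0)\<close> to the point \<open>w\<close> where the line through \<open>(1, 0)\<close> and \<open>p\<close> meets the vertical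
  axis, \<open>(1, 0)\<close> to \<open>p\<close>, and fixes \<open>(0, 1)\<close>.  The height of \<open>w\<close> is \<open>snd p / (1 - fst p)\<close>.
\<close>

definition corner_map :: "real \<times> real \<Rightarrow> real \<times> real \<Rightarrow> real \<times> real" where
  "corner_map p q = (fst p * fst q,
     snd p / (1 - fst p) + (snd p - snd p / (1 - fst p)) * fst q + (1 - snd p / (1 - fst p)) * snd q)"

lemma corner_map_in_iff:
  assumes p: "p \<in> open_triangle"
  shows "corner_map p q \<in> open_triangle \<and> side1 p (corner_map p q) > 0 \<and> side2 p (corner_map p q) < 0 \<longleftrightarrow>
    q \<in> open_triangle"
proof -
  obtain a b where ab: "p = (a, b)" by (cases p)
  obtain x y where xy: "q = (x, y)" by (cases q)
  define h where "h = b / (1 - a)"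
  have a: "0 < a" "a < 1" and b: "0 < b" "a + b < 1"
    using p by (auto simp: open_triangle_def ab)
  have bh: "b = h * (1 - a)" and h: "0 < h" "h < 1"
    using a b by (auto simp: h_def)
  have F: "corner_map p q = (a * x, h + (b - h) * x + (1 - h) * y)"
    by (simp add: corner_map_def ab xy h_def)
  have s1: "side1 p (corner_map p q) = (1 - a) * (1 - h) * y"
    unfolding F side1_def by (simp add: ab bh algebra_simps)
  have s2: "side2 p (corner_map p q) = a * (1 - h) * (x + y - 1)"
    unfolding F side2_def by (simp add: ab bh algebra_simps)
  have 1: "side1 p (corner_map p q) > 0 \<longleftrightarrow> y > 0" "side2 p (corner_map p q) < 0 \<longleftrightarrow> x + y < 1"
    unfolding s1 s2 using a h by (auto simp: zero_less_mult_iff mult_less_0_iff)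
  have 2: "fst (corner_map p q) > 0 \<longleftrightarrow> x > 0"
    using a by (auto simp: F zero_less_mult_iff)
  have 3: "snd (corner_map p q) > 0 \<and> fst (corner_map p q) + snd (corner_map p q) < 1" if "x > 0" "y > 0" "x + y < 1"
  proof -
    have "h * (1 - x) > 0" "b * x > 0" "(1 - h) * y > 0" "h * (1 - x - y) < 1 * (1 - x - y)" "(a + b) * x < 1 * x"
      using that a b h by (auto intro!: mult_pos_pos mult_strict_right_mono)
    then show ?thesis unfolding F by (simp add: algebra_simps)
  qed
  show ?thesis
    using 1 2 3 by (auto simp: open_triangle_def xy)
qed

lemma measurable_side [measurable]:
  "side1 p \<in> borel_measurable borel" "side2 p \<in> borel_measurable borel" "corner_map p \<in> borel_measurable borel"
  unfolding side1_def[abs_def] side2_def[abs_def] corner_map_def[abs_def]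
  by (intro borel_measurable_continuous_onI continuous_intros)+

text \<open>
  The triangle \<open>p v\<^sub>2 w\<close> is an affine copy of the whole triangle, so a uniform point that falls into it is
  the image of a uniform point.
\<close>

lemma nn_integral_corner_map:
  assumes p: "p \<in> open_triangle" and g[measurable]: "g \<in> borel_measurable borel"
  shows "(\<integral>\<^sup>+q. indicator {q \<in> open_triangle. side1 p q > 0 \<and> side2 p q < 0} q * g q \<partial>triangle_measure) =
    ennreal (fst p * (1 - snd p / (1 - fst p))) * (\<integral>\<^sup>+q. g (corner_map p q) \<partial>triangle_measure)"
proof -
  let ?A = "{q \<in> open_triangle. side1 p q > 0 \<and> side2 p q < 0}"
  have [measurable]: "?A \<in> sets borel" by measurable
  have c: "fst p > 0" "1 - snd p / (1 - fst p) > 0"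
    using p by (auto simp: open_triangle_def)
  have ind: "indicator ?A (corner_map p q) = (indicator open_triangle q :: ennreal)" for q
    using corner_map_in_iff[OF p, of q] by (simp add: indicator_def)
  have "(\<integral>\<^sup>+q. indicator ?A q * g q \<partial>triangle_measure) = 2 * (\<integral>\<^sup>+q. indicator ?A q * g q \<partial>lborel)"
    by (subst nn_integral_triangle_measure) (auto intro!: arg_cong[where f = "(*) 2"] nn_integral_cong simp: indicator_def)
  also have "(\<integral>\<^sup>+q. indicator ?A q * g q \<partial>lborel) = ennreal (fst p * (1 - snd p / (1 - fst p))) *
    (\<integral>\<^sup>+q. indicator ?A (corner_map p q) * g (corner_map p q) \<partial>lborel)"
    unfolding corner_map_def using c by (intro nn_integral_triangular_change) auto
  also have "2 * \<dots> = ennreal (fst p * (1 - snd p / (1 - fst p))) *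
    (2 * (\<integral>\<^sup>+q. g (corner_map p q) * indicator open_triangle q \<partial>lborel))"
    unfolding ind by (simp add: ac_simps)
  also have "2 * (\<integral>\<^sup>+q. g (corner_map p q) * indicator open_triangle q \<partial>lborel) = (\<integral>\<^sup>+q. g (corner_map p q) \<partial>triangle_measure)"
    by (rule nn_integral_triangle_measure[symmetric]) measurable
  finally show ?thesis .
qed

lemma AE_lborel_off_hyperplane:
  fixes c :: "'a::euclidean_space"
  assumes "c \<noteq> 0"
  shows "AE q in lborel. c \<bullet> q \<noteq> d"
proof -
  have "{q. c \<bullet> q = d} \<in> sets lborel"
    by (simp add: borel_closed closed_hyperplane)
  moreover have "negligible {q. c \<bullet> q = d}"
    using assms by (intro negligible_hyperplane) auto
  ultimately have "{q. c \<bullet> q = d} \<in> null_sets lborel"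
    by (simp add: negligible_iff_null_sets null_sets_completion_iff)
  then show ?thesis
    by (auto intro: AE_I')
qed

lemma AE_side1_nonzero:
  assumes p: "p \<in> open_triangle"
  shows "AE q in triangle_measure. side1 p q \<noteq> 0"
proof -
  have "AE q in lborel. (snd p, 1 - fst p) \<bullet> q \<noteq> snd p"
    using p by (intro AE_lborel_off_hyperplane) (auto simp: open_triangle_def zero_prod_def)
  then have "AE q in lborel. side1 p q \<noteq> 0"
    by eventually_elim (auto simp: side1_def inner_prod_def algebra_simps)
  then show ?thesis
    unfolding triangle_measure_def by (intro AE_uniform_measureI) auto
qed

definition above :: "real \<times> real \<Rightarrow> (real \<times> real) set" where
  "above p = {q \<in> open_triangle. side1 p q > 0}"

lemma above_measurable [measurable]: "above p \<in> sets borel"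
  unfolding above_def by measurable

text \<open>
  The points above the line through \<open>(1, 0)\<close> and \<open>p\<close> form the triangle with base from \<open>w\<close> to \<open>(0, 1)\<close>.
\<close>

lemma emeasure_above:
  assumes p: "p \<in> open_triangle"
  shows "emeasure triangle_measure (above p) = ennreal (1 - snd p / (1 - fst p))"
proof -
  obtain a b where ab: "p = (a, b)" by (cases p)
  define h where "h = b / (1 - a)"
  have a: "0 < a" "a < 1" and b: "0 < b" "a + b < 1"
    using p by (auto simp: open_triangle_def ab)
  have bh: "b = h * (1 - a)" and h: "0 < h" "h < 1"
    using a b by (auto simp: h_def)
  have ind: "(1 * fst q, h + (- h) * fst q + (1 - h) * snd q) \<in> above p \<longleftrightarrow> q \<in> open_triangle" for q
  proof -
    obtain x y where xy: "q = (x, y)" by (cases q)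
    have s: "side1 p (1 * x, h + (- h) * x + (1 - h) * y) = (1 - a) * (1 - h) * y"
      by (simp add: side1_def ab bh algebra_simps)
    have t: "1 - (x + (h + (- h) * x + (1 - h) * y)) = (1 - h) * (1 - x - y)"
      by (simp add: algebra_simps)
    have "x + (h + (- h) * x + (1 - h) * y) < 1 \<longleftrightarrow> (1 - h) * (1 - x - y) > 0"
      unfolding t[symmetric] by linarith
    also have "\<dots> \<longleftrightarrow> x + y < 1" using h by (auto simp: zero_less_mult_iff)
    finally have t': "x + (h + (- h) * x + (1 - h) * y) < 1 \<longleftrightarrow> x + y < 1" .
    have u: "h + (- h) * x + (1 - h) * y > 0" if "x > 0" "y > 0" "x + y < 1"
    proof -
      have "h * (1 - x) > 0" "(1 - h) * y > 0" using that h by auto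
      then show ?thesis by (simp add: algebra_simps)
    qed
    have s': "side1 p (1 * x, h + (- h) * x + (1 - h) * y) > 0 \<longleftrightarrow> y > 0"
      unfolding s using mult_pos_pos[of "1 - a" "1 - h"] a h
      by (metis diff_gt_0_iff_gt mult_pos_pos zero_less_mult_pos)
    show ?thesis
      using s' t' u unfolding above_def open_triangle_def xy by auto
  qed
  have "emeasure triangle_measure (above p) = (\<integral>\<^sup>+q. indicator (above p) q \<partial>triangle_measure)"
    by simp
  also have "\<dots> = 2 * (\<integral>\<^sup>+q. indicator (above p) q * indicator open_triangle q \<partial>lborel)"
    by (rule nn_integral_triangle_measure) measurable
  also have "(\<integral>\<^sup>+q. indicator (above p) q * indicator open_triangle q \<partial>lborel) = (\<integral>\<^sup>+q. indicator (above p) q \<partial>lborel)"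
    by (intro nn_integral_cong) (auto simp: above_def indicator_def)
  also have "\<dots> = ennreal (1 * (1 - h)) *
      (\<integral>\<^sup>+q. indicator (above p) (1 * fst q, h + (- h) * fst q + (1 - h) * snd q) \<partial>lborel)"
    using h by (intro nn_integral_triangular_change) auto
  also have "(\<integral>\<^sup>+q. indicator (above p) (1 * fst q, h + (- h) * fst q + (1 - h) * snd q) \<partial>lborel) =
      (\<integral>\<^sup>+q. indicator open_triangle q \<partial>lborel)"
    unfolding indicator_def ind ..
  also have "\<dots> = ennreal (1 / 2)"
    by (simp add: emeasure_open_triangle)
  also have "2 * (ennreal (1 * (1 - h)) * ennreal (1 / 2)) = ennreal (1 - h)"
  proof -
    have "2 * (ennreal (1 * (1 - h)) * ennreal (1 / 2)) = ennreal 2 * (ennreal (1 * (1 - h)) * ennreal (1 / 2))"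
      by (simp only: ennreal_numeral)
    also have "\<dots> = ennreal (2 * (1 * (1 - h) * (1 / 2)))"
      using h by (simp only: ennreal_mult' [symmetric] ennreal_mult'' [symmetric])
    also have "2 * (1 * (1 - h) * (1 / 2)) = 1 - h" by simp
    finally show ?thesis .
  qed
  finally show ?thesis
    by (simp add: h_def ab)
qed

definition corner_area :: "real \<times> real \<Rightarrow> real" where
  "corner_area p = fst p * (1 - snd p / (1 - fst p))"

lemma corner_area_eq: "p \<in> open_triangle \<Longrightarrow> corner_area p = fst p * (1 - fst p - snd p) / (1 - fst p)"
  by (auto simp: corner_area_def open_triangle_def field_simps)

lemma emeasure_above_near:
  assumes p: "p \<in> open_triangle"
  shows "emeasure triangle_measure {q \<in> above p. side2 p q \<ge> 0} = ennreal (1 - fst p - snd p)"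
proof -
  interpret prob_space triangle_measure by (rule prob_space_triangle_measure)
  let ?A = "{q \<in> open_triangle. side1 p q > 0 \<and> side2 p q < 0}"
  have [measurable]: "?A \<in> sets borel" by measurable
  have A: "emeasure triangle_measure ?A = ennreal (corner_area p)"
    using nn_integral_corner_map[OF p, of "\<lambda>_. 1"] emeasure_space_1 by (simp add: corner_area_def)
  have "{q \<in> above p. side2 p q \<ge> 0} = above p - ?A"
    by (auto simp: above_def)
  then have "emeasure triangle_measure {q \<in> above p. side2 p q \<ge> 0} =
      emeasure triangle_measure (above p) - emeasure triangle_measure ?A"
    by (simp add: emeasure_Diff above_def Collect_mono)
  also have "\<dots> = ennreal (1 - snd p / (1 - fst p) - corner_area p)"
    unfolding A emeasure_above[OF p] using p
    by (intro ennreal_minus) (auto simp: corner_area_def open_triangle_def)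
  also have "1 - snd p / (1 - fst p) - corner_area p = 1 - fst p - snd p"
  proof -
    define h where "h = snd p / (1 - fst p)"
    have "snd p = h * (1 - fst p)"
      using p by (simp add: open_triangle_def h_def)
    then show ?thesis
      unfolding corner_area_def h_def[symmetric] by (simp add: algebra_simps)
  qed
  finally show ?thesis .
qed

section \<open>Independent points beyond the first chord\<close>

definition vertex_weight :: "real \<Rightarrow> (real \<times> real) set \<Rightarrow> ennreal" where
  "vertex_weight z S = ennreal (z ^ f0 (convex hull S))"

lemma measurable_vertex_weight:
  fixes y :: "'i \<Rightarrow> 'w \<Rightarrow> real \<times> real"
  assumes "finite C" "finite I" "\<And>i. i \<in> I \<Longrightarrow> y i \<in> borel_measurable N"
  shows "(\<lambda>\<omega>. vertex_weight z (C \<union> (\<lambda>i. y i \<omega>) ` I)) \<in> borel_measurable N"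
proof -
  define F where "F = (\<lambda>c _. c) ` C \<union> y ` I"
  have "(\<lambda>\<omega>. f0 (convex hull ((\<lambda>y. y \<omega>) ` F))) \<in> measurable N (count_space UNIV)"
    using assms by (intro measurable_f0_convex_hull) (auto simp: F_def)
  moreover have "(\<lambda>y. y \<omega>) ` F = C \<union> (\<lambda>i. y i \<omega>) ` I" for \<omega>
    by (simp add: F_def image_Un image_image)
  ultimately show ?thesis
    unfolding vertex_weight_def by (auto intro: measurable_compose)
qed

text \<open>
  Points that the first vertex hides are moved to \<open>(0, 1)\<close>, which is a vertex anyway.  This replaces the random
  subset of points beyond the chord by a family with a fixed index set, to which
  \<open>measurable_vertex_weight\<close> applies.
\<close>

definition clip :: "real \<times> real \<Rightarrow> real \<times> real \<Rightarrow> real \<times> real" where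
  "clip p q = (if side2 p q < 0 then q else (0, 1))"

lemma measurable_clip [measurable]: "clip p \<in> borel_measurable borel"
  unfolding clip_def[abs_def] by measurable

interpretation triangle_product: product_sigma_finite "\<lambda>_::nat. triangle_measure"
proof -
  interpret prob_space triangle_measure by (rule prob_space_triangle_measure)
  show "product_sigma_finite (\<lambda>_::nat. triangle_measure)"
    by standard
qed

abbreviation triangle_points :: "nat set \<Rightarrow> (nat \<Rightarrow> real \<times> real) measure" where
  "triangle_points I \<equiv> PiM I (\<lambda>_. triangle_measure)"

text \<open>
  Conditionally on the first vertex \<open>p\<close>, each remaining point above the line \<open>v\<^sub>1 p\<close> is either hidden, with
  weight \<open>1 - fst p - snd p\<close>, or beyond the chord, where it is the image of a uniform point.  Expanding the
  product over the points gives a sum over the set \<open>J\<close> of indices beyond the chord.  The fixed set \<open>C\<close>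
  varies in the induction because it absorbs the points already integrated.
\<close>

lemma nn_integral_above_split:
  assumes p: "p \<in> open_triangle" and "finite I" "finite C" "(0, 1) \<in> C"
  shows "(\<integral>\<^sup>+x. (\<Prod>i\<in>I. indicator (above p) (x i)) * vertex_weight z (C \<union> (\<lambda>i. clip p (x i)) ` I) \<partial>triangle_points I) =
    (\<Sum>J\<in>Pow I. ennreal (1 - fst p - snd p) ^ card (I - J) * ennreal (corner_area p) ^ card J *
       (\<integral>\<^sup>+x. vertex_weight z (C \<union> (\<lambda>i. corner_map p (x i)) ` J) \<partial>triangle_points J))"
  using assms(2-)
proof (induction I arbitrary: C rule: finite_induct)
  case empty
  then show ?case by simp
next
  case (insert i I)
  define R where "R I C = (\<Sum>J\<in>Pow I. ennreal (1 - fst p - snd p) ^ card (I - J) * ennreal (corner_area p) ^ card J *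
       (\<integral>\<^sup>+x. vertex_weight z (C \<union> (\<lambda>i. corner_map p (x i)) ` J) \<partial>triangle_points J))" for I C
  have meas: "(\<lambda>x. (\<Prod>i\<in>K. indicator (above p) (x i)) * vertex_weight z (C \<union> (\<lambda>i. clip p (x i)) ` K))
    \<in> borel_measurable (triangle_points K)" if "finite K" "finite C" for K C
    using that by (intro borel_measurable_times_ennreal borel_measurable_prod_ennreal measurable_vertex_weight) measurable
  have measF: "(\<lambda>x. vertex_weight z (C \<union> (\<lambda>i. corner_map p (x i)) ` K)) \<in> borel_measurable (triangle_points K)"
    if "finite K" "finite C" for K C
    using that by (intro measurable_vertex_weight) measurable
  have measq: "(\<lambda>q. \<integral>\<^sup>+x. vertex_weight z (insert q C \<union> (\<lambda>i. corner_map p (x i)) ` J) \<partial>triangle_points J) \<in>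
      borel_measurable borel"
    if J: "J \<subseteq> I" and C: "finite C" for J C
  proof -
    interpret T: prob_space triangle_measure by (rule prob_space_triangle_measure)
    interpret prob_space "triangle_points J" by (rule prob_space_PiM) unfold_locales
    have finJ: "finite J" and iJ: "i \<notin> J"
      using J insert.hyps finite_subset by auto
    \<comment> \<open>all random points as one indexed family on the product space, with \<open>q\<close> at the fresh index \<open>i\<close>\<close>
    define y where "y k \<omega> = (if k = i then fst \<omega> else corner_map p (snd \<omega> k))"
      for k and \<omega> :: "(real \<times> real) \<times> (nat \<Rightarrow> real \<times> real)"
    have "y k \<in> borel_measurable (borel \<Otimes>\<^sub>M triangle_points J)" if "k \<in> insert i J" for k
      using that by (cases "k = i") (auto simp: y_def[abs_def])
    then have "(\<lambda>\<omega>. vertex_weight z (C \<union> (\<lambda>k. y k \<omega>) ` insert i J)) \<in> borel_measurable (borel \<Otimes>\<^sub>M triangle_points J)"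
      using finJ C by (intro measurable_vertex_weight) auto
    moreover have "C \<union> (\<lambda>k. y k \<omega>) ` insert i J = insert (fst \<omega>) C \<union> (\<lambda>i. corner_map p (snd \<omega> i)) ` J" for \<omega>
      using iJ by (auto simp: y_def)
    ultimately have "case_prod (\<lambda>q x. vertex_weight z (insert q C \<union> (\<lambda>i. corner_map p (x i)) ` J))
        \<in> borel_measurable (borel \<Otimes>\<^sub>M triangle_points J)"
      by (simp add: case_prod_unfold)
    then show ?thesis
      by (rule borel_measurable_nn_integral)
  qed
  have measb: "(\<lambda>q. \<integral>\<^sup>+x. vertex_weight z (insert (corner_map p q) C \<union> (\<lambda>i. corner_map p (x i)) ` J) \<partial>triangle_points J) \<in>
      borel_measurable triangle_measure" if "J \<subseteq> I" and "finite C" for J C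
    using measurable_compose[OF _ measq[OF that], of "corner_map p" triangle_measure] by simp
  have fin: "finite J" if "J \<in> Pow I" for J
    using that insert.hyps(1) finite_subset by auto
  have R_meas: "(\<lambda>q. R I (insert q C)) \<in> borel_measurable borel"
    unfolding R_def using measq insert.prems by (intro borel_measurable_sum borel_measurable_times) auto
  have "(\<integral>\<^sup>+x. (\<Prod>i\<in>insert i I. indicator (above p) (x i)) * vertex_weight z (C \<union> (\<lambda>i. clip p (x i)) ` insert i I)
      \<partial>triangle_points (insert i I)) =
    (\<integral>\<^sup>+q. \<integral>\<^sup>+x. (\<Prod>j\<in>insert i I. indicator (above p) ((x(i := q)) j)) *
        vertex_weight z (C \<union> (\<lambda>j. clip p ((x(i := q)) j)) ` insert i I) \<partial>triangle_points I \<partial>triangle_measure)"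
    using insert by (intro triangle_product.product_nn_integral_insert_rev meas) auto
  also have "\<dots> = (\<integral>\<^sup>+q. indicator (above p) q * R I (insert (clip p q) C) \<partial>triangle_measure)"
  proof (intro nn_integral_cong)
    fix q
    have "(\<integral>\<^sup>+x. (\<Prod>j\<in>insert i I. indicator (above p) ((x(i := q)) j)) *
        vertex_weight z (C \<union> (\<lambda>j. clip p ((x(i := q)) j)) ` insert i I) \<partial>triangle_points I) =
      (\<integral>\<^sup>+x. indicator (above p) q * ((\<Prod>j\<in>I. indicator (above p) (x j)) *
        vertex_weight z (insert (clip p q) C \<union> (\<lambda>j. clip p (x j)) ` I)) \<partial>triangle_points I)"
    proof (intro nn_integral_cong)
      fix x
      have 1: "(\<Prod>j\<in>I. indicator (above p) ((x(i := q)) j)) = (\<Prod>j\<in>I. indicator (above p) (x j) :: ennreal)"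
        using insert.hyps by (intro prod.cong) auto
      have 2: "(\<lambda>j. clip p ((x(i := q)) j)) ` I = (\<lambda>j. clip p (x j)) ` I"
        using insert.hyps by (intro image_cong) auto
      have 3: "C \<union> (\<lambda>j. clip p ((x(i := q)) j)) ` insert i I = insert (clip p q) C \<union> (\<lambda>j. clip p (x j)) ` I"
        unfolding image_insert 2 by auto
      show "(\<Prod>j\<in>insert i I. indicator (above p) ((x(i := q)) j)) *
        vertex_weight z (C \<union> (\<lambda>j. clip p ((x(i := q)) j)) ` insert i I) =
        indicator (above p) q * ((\<Prod>j\<in>I. indicator (above p) (x j)) *
        vertex_weight z (insert (clip p q) C \<union> (\<lambda>j. clip p (x j)) ` I))"
        unfolding 3 using insert.hyps 1 by (simp add: mult.assoc)
    qed
    also have "\<dots> = indicator (above p) q * (\<integral>\<^sup>+x. (\<Prod>j\<in>I. indicator (above p) (x j)) *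
        vertex_weight z (insert (clip p q) C \<union> (\<lambda>j. clip p (x j)) ` I) \<partial>triangle_points I)"
      using insert by (intro nn_integral_cmult meas) auto
    also have "(\<integral>\<^sup>+x. (\<Prod>j\<in>I. indicator (above p) (x j)) *
        vertex_weight z (insert (clip p q) C \<union> (\<lambda>j. clip p (x j)) ` I) \<partial>triangle_points I) =
        R I (insert (clip p q) C)"
      unfolding R_def using insert.prems by (intro insert.IH) auto
    finally show "(\<integral>\<^sup>+x. (\<Prod>j\<in>insert i I. indicator (above p) ((x(i := q)) j)) *
        vertex_weight z (C \<union> (\<lambda>j. clip p ((x(i := q)) j)) ` insert i I) \<partial>triangle_points I) =
        indicator (above p) q * R I (insert (clip p q) C)" .
  qed
  also have "\<dots> = (\<integral>\<^sup>+q. indicator {q \<in> open_triangle. side1 p q > 0 \<and> side2 p q < 0} q * R I (insert q C) +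
       R I C * indicator {q \<in> above p. side2 p q \<ge> 0} q \<partial>triangle_measure)"
    using insert.prems
    by (intro nn_integral_cong) (auto simp: indicator_def above_def clip_def insert_absorb)
  also have "\<dots> = (\<integral>\<^sup>+q. indicator {q \<in> open_triangle. side1 p q > 0 \<and> side2 p q < 0} q * R I (insert q C) \<partial>triangle_measure) +
       (\<integral>\<^sup>+q. R I C * indicator {q \<in> above p. side2 p q \<ge> 0} q \<partial>triangle_measure)"
  proof (intro nn_integral_add)
    have [measurable]: "{q \<in> open_triangle. side1 p q > 0 \<and> side2 p q < 0} \<in> sets borel"
      "{q \<in> above p. side2 p q \<ge> 0} \<in> sets borel"
      by measurable
    note R_meas[measurable]
    show "(\<lambda>q. indicator {q \<in> open_triangle. side1 p q > 0 \<and> side2 p q < 0} q * R I (insert q C))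
        \<in> borel_measurable triangle_measure"
      by measurable
    show "(\<lambda>q. R I C * indicator {q \<in> above p. side2 p q \<ge> 0} q) \<in> borel_measurable triangle_measure"
      by measurable
  qed
  also have "(\<integral>\<^sup>+q. indicator {q \<in> open_triangle. side1 p q > 0 \<and> side2 p q < 0} q * R I (insert q C) \<partial>triangle_measure) =
      ennreal (corner_area p) * (\<integral>\<^sup>+q. R I (insert (corner_map p q) C) \<partial>triangle_measure)"
    unfolding corner_area_def by (rule nn_integral_corner_map[OF p R_meas])
  also have "(\<integral>\<^sup>+q. R I C * indicator {q \<in> above p. side2 p q \<ge> 0} q \<partial>triangle_measure) =
      R I C * ennreal (1 - fst p - snd p)"
    by (simp add: nn_integral_cmult_indicator emeasure_above_near[OF p])
  also have "(\<integral>\<^sup>+q. R I (insert (corner_map p q) C) \<partial>triangle_measure) =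
      (\<Sum>J\<in>Pow I. ennreal (1 - fst p - snd p) ^ card (I - J) * ennreal (corner_area p) ^ card J *
       (\<integral>\<^sup>+x. vertex_weight z (C \<union> (\<lambda>i. corner_map p (x i)) ` insert i J) \<partial>triangle_points (insert i J)))"
    unfolding R_def
  proof (subst nn_integral_sum, goal_cases)
    case (1 J)
    then show ?case
      using insert.prems measb[of J C] by (intro borel_measurable_times_ennreal) auto
  next
    case 2
    show ?case
    proof (intro sum.cong refl)
      fix J assume J: "J \<in> Pow I"
      have iJ: "i \<notin> J" using J insert.hyps by auto
      have "(\<integral>\<^sup>+x. vertex_weight z (C \<union> (\<lambda>i. corner_map p (x i)) ` insert i J) \<partial>triangle_points (insert i J)) =
        (\<integral>\<^sup>+q. \<integral>\<^sup>+x. vertex_weight z (C \<union> (\<lambda>j. corner_map p ((x(i := q)) j)) ` insert i J)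
           \<partial>triangle_points J \<partial>triangle_measure)"
        using fin[OF J] iJ insert.prems
        by (intro triangle_product.product_nn_integral_insert_rev measF) auto
      also have "\<dots> = (\<integral>\<^sup>+q. \<integral>\<^sup>+x. vertex_weight z (insert (corner_map p q) C \<union> (\<lambda>j. corner_map p (x j)) ` J)
           \<partial>triangle_points J \<partial>triangle_measure)"
      proof (intro nn_integral_cong arg_cong[where f = "vertex_weight z"])
        fix q x
        have "(\<lambda>j. corner_map p ((x(i := q)) j)) ` J = (\<lambda>j. corner_map p (x j)) ` J"
          using iJ by (intro image_cong) auto
        then show "C \<union> (\<lambda>j. corner_map p ((x(i := q)) j)) ` insert i J =
            insert (corner_map p q) C \<union> (\<lambda>j. corner_map p (x j)) ` J"
          unfolding image_insert by auto
      qed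
      finally show "(\<integral>\<^sup>+q. ennreal (1 - fst p - snd p) ^ card (I - J) * ennreal (corner_area p) ^ card J *
          (\<integral>\<^sup>+x. vertex_weight z (insert (corner_map p q) C \<union> (\<lambda>i. corner_map p (x i)) ` J) \<partial>triangle_points J)
          \<partial>triangle_measure) =
        ennreal (1 - fst p - snd p) ^ card (I - J) * ennreal (corner_area p) ^ card J *
       (\<integral>\<^sup>+x. vertex_weight z (C \<union> (\<lambda>i. corner_map p (x i)) ` insert i J) \<partial>triangle_points (insert i J))"
        using J insert.prems measb[of J C] by (subst nn_integral_cmult) auto
    qed
  qed
  also have "ennreal (corner_area p) * \<dots> + R I C * ennreal (1 - fst p - snd p) = R (insert i I) C"
  proof -
    have disj: "Pow I \<inter> insert i ` Pow I = {}"
      using insert.hyps by auto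
    have inj: "inj_on (insert i) (Pow I)"
      using insert.hyps by (intro inj_onI) (metis Diff_insert_absorb PowD subsetD)
    have card: "card (insert i I - J) = Suc (card (I - J))" "card (insert i I - insert i J) = card (I - J)"
      "card (insert i J) = Suc (card J)" if "J \<in> Pow I" for J
    proof -
      have "insert i I - J = insert i (I - J)" "insert i I - insert i J = I - J" "i \<notin> J"
        using that insert.hyps by auto
      then show "card (insert i I - J) = Suc (card (I - J))" "card (insert i I - insert i J) = card (I - J)"
        "card (insert i J) = Suc (card J)"
        using that insert.hyps fin[OF that] by auto
    qed
    have "R (insert i I) C =
        (\<Sum>J\<in>Pow I. ennreal (1 - fst p - snd p) ^ Suc (card (I - J)) * ennreal (corner_area p) ^ card J *
          (\<integral>\<^sup>+x. vertex_weight z (C \<union> (\<lambda>i. corner_map p (x i)) ` J) \<partial>triangle_points J)) +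
        (\<Sum>J\<in>Pow I. ennreal (1 - fst p - snd p) ^ card (I - J) * ennreal (corner_area p) ^ Suc (card J) *
          (\<integral>\<^sup>+x. vertex_weight z (C \<union> (\<lambda>i. corner_map p (x i)) ` insert i J) \<partial>triangle_points (insert i J)))"
      unfolding R_def Pow_insert using insert.hyps disj
      by (subst sum.union_disjoint, simp, simp, simp, unfold sum.reindex[OF inj] o_def)
        (intro arg_cong2[where f = "(+)"] sum.cong refl; simp only: card)
    also have "\<dots> = R I C * ennreal (1 - fst p - snd p) + ennreal (corner_area p) *
        (\<Sum>J\<in>Pow I. ennreal (1 - fst p - snd p) ^ card (I - J) * ennreal (corner_area p) ^ card J *
          (\<integral>\<^sup>+x. vertex_weight z (C \<union> (\<lambda>i. corner_map p (x i)) ` insert i J) \<partial>triangle_points (insert i J)))"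
      unfolding R_def sum_distrib_left sum_distrib_right by (simp only: power_Suc mult_ac)
    finally show ?thesis by (simp only: add.commute)
  qed
  finally show ?case
    unfolding R_def .
qed

section \<open>The recursion for the probability generating function\<close>

text \<open>
  The recursion for the generating function \<open>g\<^sub>n\<close>.  It is stated over any normed field, so that the real function
  computed from the probabilities and its extension to complex \<open>z\<close> are instances of one function.
\<close>

fun vertex_gf :: "'a::real_normed_field \<Rightarrow> nat \<Rightarrow> 'a" where
  "vertex_gf z n = (if n = 0 then 1
     else 2 * z / (of_nat n * of_nat (n + 1)) * (\<Sum>m<n. of_nat (n - m) * vertex_gf z m))"

declare vertex_gf.simps [simp del]

lemma vertex_gf_0 [simp]: "vertex_gf z 0 = 1"
  by (simp add: vertex_gf.simps)

lemma vertex_gf_nonneg: "z \<ge> 0 \<Longrightarrow> vertex_gf z n \<ge> (0::real)"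
proof (induction n rule: less_induct)
  case (less n)
  then show ?case
    by (subst vertex_gf.simps)
      (auto simp del: of_nat_diff intro!: divide_nonneg_nonneg mult_nonneg_nonneg sum_nonneg)
qed

lemma sum_Pow_card:
  fixes f :: "nat \<Rightarrow> 'b::comm_semiring_1"
  assumes "finite I"
  shows "(\<Sum>J\<in>Pow I. f (card J)) = (\<Sum>m\<le>card I. of_nat (card I choose m) * f m)"
proof -
  have "(\<Sum>J\<in>Pow I. f (card J)) = (\<Sum>m\<le>card I. \<Sum>J\<in>{J \<in> Pow I. card J = m}. f (card J))"
    using assms by (intro sum.group[symmetric]) (auto intro: card_mono)
  also have "\<dots> = (\<Sum>m\<le>card I. of_nat (card I choose m) * f m)"
  proof (intro sum.cong refl)
    fix m
    have "(\<Sum>J\<in>{J \<in> Pow I. card J = m}. f (card J)) = of_nat (card {J \<in> Pow I. card J = m}) * f m"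
      by simp
    then show "(\<Sum>J\<in>{J \<in> Pow I. card J = m}. f (card J)) = of_nat (card I choose m) * f m"
      using n_subsets[OF assms, of m] by simp
  qed
  finally show ?thesis .
qed

text \<open>
  The point \<open>x i\<close> is seen from \<open>(1, 0)\<close> under the smallest angle.  Ties are broken by the index, so that exactly
  one of finitely many points in the triangle is first and no joint null set of ties has to be discussed.
\<close>

definition is_first :: "nat set \<Rightarrow> (nat \<Rightarrow> real \<times> real) \<Rightarrow> nat \<Rightarrow> bool" where
  "is_first I x i \<longleftrightarrow> (\<forall>j\<in>I. j \<noteq> i \<longrightarrow> (if j < i then side1 (x i) (x j) > 0 else side1 (x i) (x j) \<ge> 0))"

lemma side1_pos_iff_slope:
  assumes "p \<in> open_triangle" "q \<in> open_triangle"
  shows "side1 p q > 0 \<longleftrightarrow> snd p / (1 - fst p) < snd q / (1 - fst q)"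
    and "side1 p q \<ge> 0 \<longleftrightarrow> snd p / (1 - fst p) \<le> snd q / (1 - fst q)"
  using assms by (auto simp: side1_def open_triangle_def divide_simps mult.commute)

lemma sum_is_first:
  assumes I: "finite I" "I \<noteq> {}" and x: "\<And>i. i \<in> I \<Longrightarrow> x i \<in> open_triangle"
  shows "(\<Sum>i\<in>I. of_bool (is_first I x i)) = (1 :: ennreal)"
proof -
  define s where "s i = snd (x i) / (1 - fst (x i))" for i
  have first: "is_first I x i \<longleftrightarrow> (\<forall>j\<in>I. j \<noteq> i \<longrightarrow> (if j < i then s i < s j else s i \<le> s j))"
    if "i \<in> I" for i
    unfolding is_first_def s_def using x that by (simp add: side1_pos_iff_slope)
  \<comment> \<open>the indices of minimal slope; the first point is the one with the least such index\<close>
  define K where "K = {i \<in> I. \<forall>j\<in>I. s i \<le> s j}"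
  have "Min (s ` I) \<in> s ` I" using I by (intro Min_in) auto
  then obtain i0 where i0: "i0 \<in> I" "s i0 = Min (s ` I)" by auto
  then have "K \<noteq> {}" "finite K" using I by (auto simp: K_def)
  define i where "i = Min K"
  have iK: "i \<in> K" unfolding i_def using \<open>K \<noteq> {}\<close> \<open>finite K\<close> by (rule Min_in[rotated])
  have imin: "i \<le> j" if "j \<in> K" for j
    unfolding i_def using \<open>finite K\<close> that by simp
  have "is_first I x k \<longleftrightarrow> k = i" if k: "k \<in> I" for k
  proof
    assume f: "is_first I x k"
    have "s k \<le> s j" if "j \<in> I" for j
      using f[unfolded first[OF k]] that by (cases "j = k"; cases "j < k") (auto intro: less_imp_le)
    then have "k \<in> K" using k by (simp add: K_def)
    then have "i \<le> k" "s i = s k" using imin iK by (auto simp: K_def intro: antisym)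
    moreover have "\<not> i < k"
      using f[unfolded first[OF k]] iK \<open>s i = s k\<close> by (auto simp: K_def)
    ultimately show "k = i" by simp
  next
    assume "k = i"
    have "i \<in> I" using iK by (simp add: K_def)
    show "is_first I x k"
      unfolding \<open>k = i\<close> first[OF \<open>i \<in> I\<close>]
    proof (intro ballI impI)
      fix j assume j: "j \<in> I" "j \<noteq> i"
      have "s i \<le> s j" using iK j by (auto simp: K_def)
      moreover have "s i \<noteq> s j" if "j < i"
        using imin[of j] that j iK by (auto simp: K_def)
      ultimately show "if j < i then s i < s j else s i \<le> s j" by auto
    qed
  qed
  then have "(\<Sum>j\<in>I. of_bool (is_first I x j)) = (\<Sum>j\<in>I. if j = i then 1 else (0::ennreal))"
    by (intro sum.cong) auto
  then show ?thesis
    using I iK by (simp add: K_def)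
qed

lemma vertex_weight_base: "vertex_weight z {(1, 0), (0, 1)} = ennreal (z ^ 2)"
proof -
  have "vertices (convex hull {(1, 0), (0, 1) :: real \<times> real}) = {(1, 0), (0, 1)}"
    by (auto simp: vertices_def extreme_point_of_convex_hull_2)
  then show ?thesis
    by (simp add: vertex_weight_def f0_def power2_eq_square)
qed

text \<open>
  The map \<open>corner_map p\<close> carries the initial configuration to the one beyond \<open>p\<close>, and injective affine maps
  preserve the number of vertices.
\<close>

lemma vertex_weight_corner_map:
  assumes p: "p \<in> open_triangle"
  shows "vertex_weight z ({p, (0, 1)} \<union> (\<lambda>i. corner_map p (x i)) ` J) = vertex_weight z ({(1, 0), (0, 1)} \<union> x ` J)"
proof -
  define L where "L q = corner_map p q - corner_map p 0" for q
  have L: "L q = (fst p * fst q, (snd p - snd p / (1 - fst p)) * fst q + (1 - snd p / (1 - fst p)) * snd q)" for q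
    by (simp add: L_def corner_map_def)
  have "linear L"
    by (rule linearI) (auto simp: L ring_distribs add_divide_distrib diff_divide_distrib mult_ac)
  moreover have "inj L"
    unfolding linear_injective_0[OF \<open>linear L\<close>] using p by (auto simp: L open_triangle_def zero_prod_def)
  moreover have "{p, (0, 1)} \<union> (\<lambda>i. corner_map p (x i)) ` J = (\<lambda>q. corner_map p 0 + L q) ` ({(1, 0), (0, 1)} \<union> x ` J)"
  proof -
    have "corner_map p (1, 0) = p" "corner_map p (0, 1) = (0, 1)"
      by (auto simp: corner_map_def)
    then show ?thesis
      by (simp add: L_def image_image)
  qed
  ultimately show ?thesis
    by (simp only: vertex_weight_def f0_convex_hull_affine_image)
qed

text \<open>
  For a fixed first vertex \<open>p\<close>, almost surely no other point lies on the line \<open>v\<^sub>1 p\<close>, so the tie-breaking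
  condition becomes the product condition that all other points are above that line.
\<close>

lemma nn_integral_first_vertex:
  assumes p: "p \<in> open_triangle" and "finite I" "i \<notin> I" "z \<ge> 0"
  shows "(\<integral>\<^sup>+x. of_bool (is_first (insert i I) (x(i := p)) i) * vertex_weight z ({(1, 0), (0, 1)} \<union> (x(i := p)) ` insert i I)
      \<partial>triangle_points I) =
    ennreal z * (\<Sum>J\<in>Pow I. ennreal (1 - fst p - snd p) ^ card (I - J) * ennreal (corner_area p) ^ card J *
       (\<integral>\<^sup>+x. vertex_weight z ({(1, 0), (0, 1)} \<union> x ` J) \<partial>triangle_points J))"
proof -
  interpret T: prob_space triangle_measure by (rule prob_space_triangle_measure)
  have "AE x in triangle_points I. \<forall>j\<in>I. x j \<in> open_triangle \<and> side1 p (x j) \<noteq> 0"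
    using AE_triangle_measure AE_side1_nonzero[OF p] \<open>finite I\<close> T.prob_space_axioms
    by (intro AE_finite_allI AE_PiM_component) auto
  then have "AE x in triangle_points I.
     of_bool (is_first (insert i I) (x(i := p)) i) * vertex_weight z ({(1, 0), (0, 1)} \<union> (x(i := p)) ` insert i I) =
     ennreal z * ((\<Prod>j\<in>I. indicator (above p) (x j)) * vertex_weight z ({p, (0, 1)} \<union> (\<lambda>j. clip p (x j)) ` I))"
  proof eventually_elim
    case (elim x)
    have im: "(x(i := p)) ` insert i I = insert p (x ` I)"
      using \<open>i \<notin> I\<close> by (auto simp: fun_upd_def)
    have first: "is_first (insert i I) (x(i := p)) i \<longleftrightarrow> (\<forall>j\<in>I. x j \<in> above p)"
      unfolding is_first_def using \<open>i \<notin> I\<close> elim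
      by (auto simp: above_def less_le split: if_splits)
    have prod: "(\<Prod>j\<in>I. indicator (above p) (x j)) = (of_bool (\<forall>j\<in>I. x j \<in> above p) :: ennreal)"
      using \<open>finite I\<close> by (auto simp: indicator_def)
    show ?case
    proof (cases "\<forall>j\<in>I. x j \<in> above p")
      case True
      have "f0 (convex hull ({(1, 0), (0, 1), p} \<union> x ` I)) =
         Suc (f0 (convex hull ({p, (0, 1)} \<union> {q \<in> x ` I. side2 p q < 0})))"
        using p \<open>finite I\<close> True by (intro f0_hull_peel_first_vertex) (auto simp: above_def)
      moreover have "{p, (0, 1)} \<union> {q \<in> x ` I. side2 p q < 0} = {p, (0, 1)} \<union> (\<lambda>j. clip p (x j)) ` I"
        by (auto simp: clip_def)
      moreover have "{(1, 0), (0, 1)} \<union> insert p (x ` I) = {(1, 0), (0, 1), p} \<union> x ` I"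
        by auto
      ultimately show ?thesis
        using True \<open>z \<ge> 0\<close> unfolding im first prod vertex_weight_def by (simp add: ennreal_mult)
    next
      case False
      then show ?thesis
        unfolding first prod by (simp only: of_bool_eq mult_zero_left mult_zero_right)
    qed
  qed
  then have "(\<integral>\<^sup>+x. of_bool (is_first (insert i I) (x(i := p)) i) * vertex_weight z ({(1, 0), (0, 1)} \<union> (x(i := p)) ` insert i I)
      \<partial>triangle_points I) =
     (\<integral>\<^sup>+x. ennreal z * ((\<Prod>j\<in>I. indicator (above p) (x j)) * vertex_weight z ({p, (0, 1)} \<union> (\<lambda>j. clip p (x j)) ` I)) \<partial>triangle_points I)"
    by (rule nn_integral_cong_AE)
  also have "\<dots> = ennreal z * (\<integral>\<^sup>+x. (\<Prod>j\<in>I. indicator (above p) (x j)) * vertex_weight z ({p, (0, 1)} \<union> (\<lambda>j. clip p (x j)) ` I) \<partial>triangle_points I)"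
    using \<open>finite I\<close>
    by (intro nn_integral_cmult borel_measurable_times_ennreal borel_measurable_prod_ennreal measurable_vertex_weight) measurable
  also have "(\<integral>\<^sup>+x. (\<Prod>j\<in>I. indicator (above p) (x j)) * vertex_weight z ({p, (0, 1)} \<union> (\<lambda>j. clip p (x j)) ` I) \<partial>triangle_points I) =
    (\<Sum>J\<in>Pow I. ennreal (1 - fst p - snd p) ^ card (I - J) * ennreal (corner_area p) ^ card J *
       (\<integral>\<^sup>+x. vertex_weight z ({(1, 0), (0, 1)} \<union> x ` J) \<partial>triangle_points J))"
    using \<open>finite I\<close> by (subst nn_integral_above_split[OF p]) (simp_all only: vertex_weight_corner_map[OF p] finite.intros insert_iff simp_thms)
  finally show ?thesis .
qed

lemma nn_integral_triangle_powers:
  "(\<integral>\<^sup>+p. ennreal (1 - fst p - snd p) ^ k * ennreal (corner_area p) ^ m \<partial>triangle_measure) =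
   ennreal (2 * (fact m * fact (Suc k) / (real (k + m + 1) * fact (k + m + 2))))"
proof -
  have [measurable]: "corner_area \<in> borel_measurable borel"
    "(\<lambda>p. 1 - fst p - snd p) \<in> borel_measurable (borel :: (real \<times> real) measure)"
    unfolding corner_area_def[abs_def] borel_prod[symmetric] by measurable
  have "(\<integral>\<^sup>+p. ennreal (1 - fst p - snd p) ^ k * ennreal (corner_area p) ^ m \<partial>triangle_measure) =
    2 * (\<integral>\<^sup>+p. ennreal (1 - fst p - snd p) ^ k * ennreal (corner_area p) ^ m * indicator open_triangle p \<partial>lborel)"
    by (rule nn_integral_triangle_measure) measurable
  also have "(\<integral>\<^sup>+p. ennreal (1 - fst p - snd p) ^ k * ennreal (corner_area p) ^ m * indicator open_triangle p \<partial>lborel) =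
    (\<integral>\<^sup>+q. ennreal ((1 - fst q - snd q) ^ k * (fst q * (1 - fst q - snd q) / (1 - fst q)) ^ m) *
      indicator open_triangle q \<partial>lborel)"
  proof (intro nn_integral_cong)
    fix q :: "real \<times> real"
    show "ennreal (1 - fst q - snd q) ^ k * ennreal (corner_area q) ^ m * indicator open_triangle q =
      ennreal ((1 - fst q - snd q) ^ k * (fst q * (1 - fst q - snd q) / (1 - fst q)) ^ m) * indicator open_triangle q"
    proof (cases "q \<in> open_triangle")
      case True
      then have "1 - fst q - snd q \<ge> 0" "corner_area q \<ge> 0"
        by (auto simp: corner_area_def open_triangle_def)
      then show ?thesis
        unfolding corner_area_eq[OF True, symmetric] by (simp add: ennreal_mult ennreal_power)
    qed simp
  qed
  also have "\<dots> = ennreal (fact m * fact (Suc k) / (real (k + m + 1) * fact (k + m + 2)))"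
    by (rule nn_integral_open_triangle_powers)
  finally show ?thesis
    by (simp only: ennreal_mult' ennreal_numeral zero_le_numeral)
qed

lemma measurable_is_first:
  assumes "finite I" "i \<in> I"
  shows "Measurable.pred (triangle_points I) (\<lambda>x. is_first I x i)"
proof -
  have [measurable]: "(fst :: real \<times> real \<Rightarrow> real) \<in> borel_measurable borel" "(snd :: real \<times> real \<Rightarrow> real) \<in> borel_measurable borel"
    by (intro borel_measurable_continuous_onI continuous_intros)+
  have [measurable]: "(\<lambda>x. side1 (x i) (x j)) \<in> borel_measurable (triangle_points I)" if "j \<in> I" for j
    unfolding side1_def using that assms(2) by measurable
  show ?thesis
    unfolding is_first_def using assms by (intro pred_intros_finite) measurable
qed

text \<open>
  The \<open>n\<close> choices for the first vertex, the choice of the \<open>m\<close> points beyond the chord and the Beta integral combine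
  to the coefficient of the recursion.
\<close>

lemma first_vertex_coefficient:
  assumes "m < n"
  shows "real n * (real (n - 1 choose m) * (2 * (fact m * fact (n - m) / (real n * fact (n + 1))))) =
    2 / (real n * real (n + 1)) * real (n - m)"
proof -
  obtain k where n: "n = Suc (m + k)"
    using assms less_iff_Suc_add by auto
  have "fact m * fact k * real (m + k choose m) = fact (m + k)"
    using binomial_fact_lemma[of m "m + k"] by (metis add_diff_cancel_left' le_add1 of_nat_fact of_nat_mult)
  then have "fact m * fact (Suc k) * real (m + k choose m) = real (Suc k) * fact (m + k)"
    by (simp add: mult_ac)
  then show ?thesis
    unfolding n by (simp add: divide_simps mult_ac)
qed

text \<open>
  Induction on the number of points.  The statement speaks of an arbitrary index set, so the induction
  hypothesis applies directly to the set of points beyond the first chord.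
\<close>

lemma vertex_pgf:
  assumes z: "z \<ge> 0" and "finite I"
  shows "(\<integral>\<^sup>+x. vertex_weight z ({(1, 0), (0, 1)} \<union> x ` I) \<partial>triangle_points I) =
    ennreal (z\<^sup>2 * vertex_gf z (card I))"
  using \<open>finite I\<close>
proof (induction "card I" arbitrary: I rule: less_induct)
  case (less I)
  interpret T: prob_space triangle_measure by (rule prob_space_triangle_measure)
  let ?w = "\<lambda>x. vertex_weight z ({(1, 0), (0, 1)} \<union> x ` I)"
  define n where "n = card I"
  have meas: "?w \<in> borel_measurable (triangle_points I)"
    using less.prems by (intro measurable_vertex_weight) auto
  show ?case
  proof (cases "I = {}")
    case True
    then show ?thesis
      by (simp add: PiM_empty nn_integral_count_space_finite vertex_weight_base)
  next
    case False
    then have n: "n > 0" using less.prems by (simp add: n_def card_gt_0_iff)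
    define c where "c m = 2 * (fact m * fact (n - m) / (real n * fact (n + 1)))" for m
    have first: "(\<integral>\<^sup>+x. of_bool (is_first I x i) * ?w x \<partial>triangle_points I) =
        ennreal (z * (\<Sum>m\<le>n - 1. real (n - 1 choose m) * (c m * (z\<^sup>2 * vertex_gf z m))))" if i: "i \<in> I" for i
    proof -
      define I' where "I' = I - {i}"
      have I': "I = insert i I'" "i \<notin> I'" "finite I'" "card I' = n - 1"
        using i less.prems by (auto simp: I'_def n_def)
      have IH: "(\<integral>\<^sup>+x. vertex_weight z ({(1, 0), (0, 1)} \<union> x ` J) \<partial>triangle_points J) =
          ennreal (z\<^sup>2 * vertex_gf z (card J))" if "J \<in> Pow I'" for J
      proof (rule less.hyps)
        have "card J \<le> card I'" using that I'(3) by (intro card_mono) auto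
        then show "card J < card I" using I'(4) n by (simp add: n_def)
        show "finite J" using that I' finite_subset by auto
      qed
      have m: "(\<lambda>x. of_bool (is_first I x i) * ?w x) \<in> borel_measurable (triangle_points I)"
        using measurable_is_first[OF less.prems i] meas by measurable
      have "(\<integral>\<^sup>+x. of_bool (is_first I x i) * ?w x \<partial>triangle_points I) =
        (\<integral>\<^sup>+p. \<integral>\<^sup>+x. of_bool (is_first (insert i I') (x(i := p)) i) *
            vertex_weight z ({(1, 0), (0, 1)} \<union> (x(i := p)) ` insert i I') \<partial>triangle_points I' \<partial>triangle_measure)"
        using m I' unfolding I'(1) by (intro triangle_product.product_nn_integral_insert_rev) auto
      also have "\<dots> = (\<integral>\<^sup>+p. ennreal z * (\<Sum>J\<in>Pow I'. ennreal (1 - fst p - snd p) ^ (n - 1 - card J) * ennreal (corner_area p) ^ card J *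
           ennreal (z\<^sup>2 * vertex_gf z (card J))) \<partial>triangle_measure)"
      proof (rule nn_integral_cong_AE)
        show "AE p in triangle_measure. (\<integral>\<^sup>+x. of_bool (is_first (insert i I') (x(i := p)) i) *
            vertex_weight z ({(1, 0), (0, 1)} \<union> (x(i := p)) ` insert i I') \<partial>triangle_points I') =
          ennreal z * (\<Sum>J\<in>Pow I'. ennreal (1 - fst p - snd p) ^ (n - 1 - card J) * ennreal (corner_area p) ^ card J *
           ennreal (z\<^sup>2 * vertex_gf z (card J)))"
          using AE_triangle_measure
        proof eventually_elim
          case (elim p)
          have card: "card (I' - J) = n - 1 - card J" if "J \<in> Pow I'" for J
            using that I' by (subst card_Diff_subset) (auto intro: finite_subset)
          show ?case
            unfolding nn_integral_first_vertex[OF elim I'(3,2) z]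
            by (intro arg_cong2[where f = "(*)"] refl sum.cong) (simp_all only: card IH)
        qed
      qed
      also have "\<dots> = ennreal z * (\<Sum>J\<in>Pow I'. (\<integral>\<^sup>+p. ennreal (1 - fst p - snd p) ^ (n - 1 - card J) * ennreal (corner_area p) ^ card J
           \<partial>triangle_measure) * ennreal (z\<^sup>2 * vertex_gf z (card J)))"
      proof -
        have [measurable]: "corner_area \<in> borel_measurable borel"
          "(\<lambda>p. 1 - fst p - snd p) \<in> borel_measurable (borel :: (real \<times> real) measure)"
          unfolding corner_area_def[abs_def] borel_prod[symmetric] by measurable
        show ?thesis
          by (simp add: nn_integral_cmult nn_integral_sum nn_integral_multc)
      qed
      also have "\<dots> = ennreal z * (\<Sum>J\<in>Pow I'. ennreal (c (card J) * (z\<^sup>2 * vertex_gf z (card J))))"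
      proof (intro arg_cong2[where f = "(*)"] refl sum.cong)
        fix J assume "J \<in> Pow I'"
        then have J: "card J \<le> n - 1" using card_mono[of I' J] I'(3,4) by auto
        then have eq: "Suc (n - 1 - card J) = n - card J" "n - 1 - card J + card J + 1 = n"
          "n - 1 - card J + card J + 2 = n + 1"
          using n by auto
        show "(\<integral>\<^sup>+p. ennreal (1 - fst p - snd p) ^ (n - 1 - card J) * ennreal (corner_area p) ^ card J
           \<partial>triangle_measure) * ennreal (z\<^sup>2 * vertex_gf z (card J)) = ennreal (c (card J) * (z\<^sup>2 * vertex_gf z (card J)))"
          unfolding nn_integral_triangle_powers eq c_def by (subst ennreal_mult'[symmetric]) auto
      qed
      also have "\<dots> = ennreal (z * (\<Sum>J\<in>Pow I'. c (card J) * (z\<^sup>2 * vertex_gf z (card J))))"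
        using z vertex_gf_nonneg[OF z] by (subst sum_ennreal) (auto simp: c_def ennreal_mult')
      also have "(\<Sum>J\<in>Pow I'. c (card J) * (z\<^sup>2 * vertex_gf z (card J))) =
          (\<Sum>m\<le>n - 1. real (n - 1 choose m) * (c m * (z\<^sup>2 * vertex_gf z m)))"
        using sum_Pow_card[OF I'(3), of "\<lambda>m. c m * (z\<^sup>2 * vertex_gf z m)"] I'(4) by simp
      finally show ?thesis .
    qed
    have "AE x in triangle_points I. \<forall>i\<in>I. x i \<in> open_triangle"
      using AE_triangle_measure less.prems T.prob_space_axioms
      by (intro AE_finite_allI AE_PiM_component) auto
    then have "AE x in triangle_points I. ?w x = (\<Sum>i\<in>I. of_bool (is_first I x i) * ?w x)"
    proof eventually_elim
      case (elim x)
      have "(\<Sum>i\<in>I. of_bool (is_first I x i)) = (1 :: ennreal)"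
        using elim False less.prems by (intro sum_is_first) auto
      then show ?case
        by (simp only: sum_distrib_right[symmetric] mult_1_left)
    qed
    then have "(\<integral>\<^sup>+x. ?w x \<partial>triangle_points I) = (\<integral>\<^sup>+x. (\<Sum>i\<in>I. of_bool (is_first I x i) * ?w x) \<partial>triangle_points I)"
      by (rule nn_integral_cong_AE)
    also have "\<dots> = (\<Sum>i\<in>I. \<integral>\<^sup>+x. of_bool (is_first I x i) * ?w x \<partial>triangle_points I)"
    proof (rule nn_integral_sum)
      fix i assume "i \<in> I"
      from measurable_is_first[OF less.prems this] meas
      show "(\<lambda>x. of_bool (is_first I x i) * ?w x) \<in> borel_measurable (triangle_points I)"
        by measurable
    qed
    also have "\<dots> = ennreal (real n * (z * (\<Sum>m\<le>n - 1. real (n - 1 choose m) * (c m * (z\<^sup>2 * vertex_gf z m)))))"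
      using first by (simp add: n_def ennreal_mult' ennreal_of_nat_eq_real_of_nat)
    also have "real n * (z * (\<Sum>m\<le>n - 1. real (n - 1 choose m) * (c m * (z\<^sup>2 * vertex_gf z m)))) =
        z\<^sup>2 * (z * (\<Sum>m\<le>n - 1. (real n * (real (n - 1 choose m) * c m)) * vertex_gf z m))"
      by (simp add: sum_distrib_left mult_ac)
    also have "{..n - 1} = {..<n}"
      using n by auto
    also have "z * (\<Sum>m<n. (real n * (real (n - 1 choose m) * c m)) * vertex_gf z m) =
        z * (\<Sum>m<n. (2 / (real n * real (n + 1)) * real (n - m)) * vertex_gf z m)"
    proof -
      have "(\<Sum>m<n. (real n * (real (n - 1 choose m) * c m)) * vertex_gf z m) =
          (\<Sum>m<n. (2 / (real n * real (n + 1)) * real (n - m)) * vertex_gf z m)"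
      proof (rule sum.cong[OF refl])
        fix m assume "m \<in> {..<n}"
        then have "m < n" by simp
        then show "(real n * (real (n - 1 choose m) * c m)) * vertex_gf z m =
            (2 / (real n * real (n + 1)) * real (n - m)) * vertex_gf z m"
          unfolding c_def by (simp only: first_vertex_coefficient)
      qed
      then show ?thesis by (simp only:)
    qed
    also have "\<dots> = vertex_gf z n"
      using n by (subst (2) vertex_gf.simps) (simp add: sum_distrib_left sum_divide_distrib mult_ac)
    finally show ?thesis
      by (simp only: n_def)
  qed
qed

section \<open>The generating function of the vertex count\<close>

lemma unit_triangle_eq: "unit_triangle = {q. 0 \<le> fst q \<and> 0 \<le> snd q \<and> fst q + snd q \<le> 1}"
proof (intro set_eqI iffI)
  fix q assume "q \<in> {q. 0 \<le> fst q \<and> 0 \<le> snd q \<and> fst q + snd q \<le> (1::real)}"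
  then have "0 \<le> 1 - fst q - snd q \<and> 0 \<le> fst q \<and> 0 \<le> snd q \<and> (1 - fst q - snd q) + fst q + snd q = 1 \<and>
    q = (1 - fst q - snd q) *\<^sub>R (0, 0) + fst q *\<^sub>R (1, 0) + snd q *\<^sub>R (0, 1)"
    by (cases q) auto
  then show "q \<in> unit_triangle"
    unfolding unit_triangle_def convex_hull_3 by blast
qed (auto simp: unit_triangle_def convex_hull_3)

lemma uniform_measure_unit_triangle: "uniform_measure lborel unit_triangle = triangle_measure"
proof -
  have "AE q in lborel. (1::real, 0::real) \<bullet> q \<noteq> 0"
    "AE q in lborel. (0::real, 1::real) \<bullet> q \<noteq> 0" "AE q in lborel. (1::real, 1::real) \<bullet> q \<noteq> 1"
    by (auto intro!: AE_lborel_off_hyperplane simp: zero_prod_def)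
  then have AE: "AE q in lborel. q \<in> unit_triangle \<longleftrightarrow> q \<in> open_triangle"
    by eventually_elim (auto simp: unit_triangle_eq open_triangle_def inner_prod_def)
  have [measurable]: "unit_triangle \<in> sets borel"
    unfolding unit_triangle_eq
    by (intro borel_closed closed_Collect_conj closed_Collect_le continuous_intros)
  have "emeasure lborel unit_triangle = emeasure lborel open_triangle"
    using AE by (intro emeasure_eq_AE) auto
  moreover have "AE q in lborel. indicator unit_triangle q / e = (indicator open_triangle q / e :: ennreal)" for e
    using AE by eventually_elim (simp add: indicator_def)
  ultimately show ?thesis
    unfolding triangle_measure_def uniform_measure_def by (intro density_cong) auto
qed

lemma expectation_power_f0:
  fixes X :: "nat \<Rightarrow> 'a \<Rightarrow> real \<times> real" and z :: real
  assumes "prob_space M" and indep: "prob_space.indep_vars M (\<lambda>_. borel) X {1..n}"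
    and uniform: "\<And>i. i \<in> {1..n} \<Longrightarrow> distr M borel (X i) = uniform_measure lborel unit_triangle"
    and n: "n \<ge> 1" and z: "z \<ge> 0"
  shows "(\<integral>\<omega>. z ^ f0 (hull_polygon n (\<lambda>i. X i \<omega>)) \<partial>M) = z\<^sup>2 * vertex_gf z n"
proof -
  interpret prob_space M by fact
  have X[measurable]: "X i \<in> borel_measurable M" if "i \<in> {1..n}" for i
    using indep that by (auto simp: indep_vars_def)
  have "distr M (\<Pi>\<^sub>M i\<in>{1..n}. borel) (\<lambda>\<omega>. \<lambda>i\<in>{1..n}. X i \<omega>) = (\<Pi>\<^sub>M i\<in>{1..n}. distr M borel (X i))"
    using n indep by (subst indep_vars_iff_distr_eq_PiM'[symmetric]) auto
  also have "\<dots> = triangle_points {1..n}"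
    using uniform by (intro PiM_cong) (auto simp: uniform_measure_unit_triangle)
  finally have distr: "distr M (\<Pi>\<^sub>M i\<in>{1..n}. borel) (\<lambda>\<omega>. \<lambda>i\<in>{1..n}. X i \<omega>) = triangle_points {1..n}" .
  have meas: "(\<lambda>\<omega>. f0 (convex hull ((\<lambda>y. y \<omega>) ` ({\<lambda>_. (1, 0), \<lambda>_. (0, 1)} \<union> X ` {1..n})))) \<in> measurable M (count_space UNIV)"
    using X by (intro measurable_f0_convex_hull) auto
  have hull: "convex hull ((\<lambda>y. y \<omega>) ` ({\<lambda>_. (1, 0), \<lambda>_. (0, 1)} \<union> X ` {1..n})) = hull_polygon n (\<lambda>i. X i \<omega>)" for \<omega>
    by (simp add: hull_polygon_def image_Un image_image)
  have "(\<integral>\<^sup>+\<omega>. ennreal (z ^ f0 (hull_polygon n (\<lambda>i. X i \<omega>))) \<partial>M) =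
      (\<integral>\<^sup>+\<omega>. vertex_weight z ({(1, 0), (0, 1)} \<union> (\<lambda>i\<in>{1..n}. X i \<omega>) ` {1..n}) \<partial>M)"
    by (intro nn_integral_cong) (simp add: vertex_weight_def hull_polygon_def)
  also have "\<dots> = (\<integral>\<^sup>+x. vertex_weight z ({(1, 0), (0, 1)} \<union> x ` {1..n})
      \<partial>distr M (\<Pi>\<^sub>M i\<in>{1..n}. borel) (\<lambda>\<omega>. \<lambda>i\<in>{1..n}. X i \<omega>))"
  proof -
    have 1: "(\<lambda>\<omega>. \<lambda>i\<in>{1..n}. X i \<omega>) \<in> measurable M (\<Pi>\<^sub>M i\<in>{1..n}. borel)"
      by measurable
    have "(\<lambda>x. vertex_weight z ({(1, 0), (0, 1)} \<union> x ` {1..n})) \<in>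
        borel_measurable (\<Pi>\<^sub>M i\<in>{1..n}. borel)"
      by (intro measurable_vertex_weight) auto
    then have 2: "(\<lambda>x. vertex_weight z ({(1, 0), (0, 1)} \<union> x ` {1..n})) \<in>
        borel_measurable (distr M (\<Pi>\<^sub>M i\<in>{1..n}. borel) (\<lambda>\<omega>. \<lambda>i\<in>{1..n}. X i \<omega>))"
      by simp
    show ?thesis
      by (rule nn_integral_distr[OF 1 2, symmetric])
  qed
  also have "\<dots> = ennreal (z\<^sup>2 * vertex_gf z n)"
    unfolding distr using vertex_pgf[OF z, of "{1..n}"] by simp
  finally have "(\<integral>\<^sup>+\<omega>. ennreal (z ^ f0 (hull_polygon n (\<lambda>i. X i \<omega>))) \<partial>M) = ennreal (z\<^sup>2 * vertex_gf z n)" .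
  moreover have "(\<lambda>\<omega>. z ^ f0 (hull_polygon n (\<lambda>i. X i \<omega>))) \<in> borel_measurable M"
    using meas unfolding hull by (auto intro: measurable_compose)
  ultimately show ?thesis
    using z vertex_gf_nonneg[OF z] by (subst integral_eq_nn_integral) auto
qed

section \<open>Growth of the generating function near 1\<close>

text \<open>
  The sequence \<open>n (n + 1) g\<^sub>n\<close> is a convolution of \<open>2 z g\<close> with the identity, so its second difference is
  \<open>2 z g\<^sub>n\<close>.
\<close>

lemma vertex_gf_three_term:
  fixes z :: "'a::real_normed_field"
  shows "of_nat ((n + 2) * (n + 3)) * vertex_gf z (n + 2) =
    (of_nat (2 * (n + 1) * (n + 2)) + 2 * z) * vertex_gf z (n + 1) - of_nat (n * (n + 1)) * vertex_gf z n"
proof -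
  define a where "a n = of_nat (n * (n + 1)) * vertex_gf z n" for n
  have a: "a n = 2 * z * (\<Sum>m<n. of_nat (n - m) * vertex_gf z m)" for n
  proof (cases "n = 0")
    case False
    then have "(of_nat n :: 'a) \<noteq> 0" "(of_nat (n + 1) :: 'a) \<noteq> 0"
      by (simp_all only: of_nat_eq_0_iff) auto
    then show ?thesis
      unfolding a_def using False by (subst vertex_gf.simps) (simp only: of_nat_mult if_False, simp)
  qed (simp add: a_def)
  have diff: "a (Suc n) - a n = 2 * z * (\<Sum>m\<le>n. vertex_gf z m)" for n
  proof -
    have "(\<Sum>m<Suc n. of_nat (Suc n - m) * vertex_gf z m) =
        (\<Sum>m<n. of_nat (n - m) * vertex_gf z m + vertex_gf z m) + vertex_gf z n"
      unfolding sum.lessThan_Suc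
      by (intro arg_cong2[where f = "(+)"] sum.cong) (auto simp: Suc_diff_le less_imp_le algebra_simps simp del: of_nat_diff)
    then show ?thesis
      by (simp only: a sum.distrib) (simp add: algebra_simps lessThan_Suc_atMost[symmetric])
  qed
  have "(a (Suc (Suc n)) - a (Suc n)) - (a (Suc n) - a n) = 2 * z * vertex_gf z (Suc n)"
    unfolding diff by (simp add: algebra_simps)
  then show ?thesis
    by (simp add: a_def algebra_simps)
qed

text \<open>
  The number \<open>b\<^sub>n\<close> with \<open>g\<^sub>n\<^sub>+\<^sub>1 = g\<^sub>n (1 + b\<^sub>n / (n + 1))\<close>, as computed from the three-term
  recursion.
\<close>

fun ratio_excess :: "'a::real_normed_field \<Rightarrow> nat \<Rightarrow> 'a" where
  "ratio_excess z 0 = z - 1"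
| "ratio_excess z (Suc n) =
     (2 * (z - 1) + of_nat (n * (n + 1)) * ratio_excess z n / (of_nat (n + 1) + ratio_excess z n)) / of_nat (n + 3)"

lemma norm_of_nat_plus_ge:
  fixes b :: "'a::real_normed_field"
  assumes "norm b \<le> 1/2"
  shows "norm (of_nat (n + 1) + b) \<ge> real n + 1/2"
  using assms norm_diff_ineq[of "of_nat (n + 1)" b] unfolding norm_of_nat by simp

text \<open>
  The disc of radius \<open>1/2\<close> is invariant under the recursion for \<open>b\<^sub>n\<close> if \<open>z\<close> is close to 1.  Hence no factor
  \<open>1 + b\<^sub>n / (n + 1)\<close> vanishes, and the generating functions have a common zero-free disc around 1.
  The radius \<open>3/8\<close> is chosen such that the limit of \<open>b\<^sub>n\<close> obeys the same bound \<open>1/2\<close>.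
\<close>

lemma norm_ratio_excess_le:
  fixes z :: "'a::real_normed_field"
  assumes "norm (z - 1) \<le> 3/8"
  shows "norm (ratio_excess z n) \<le> 1/2"
proof (induction n)
  case (Suc n)
  let ?b = "ratio_excess z n"
  have "norm (of_nat (n * (n + 1)) * ?b / (of_nat (n + 1) + ?b)) \<le> real (n * (n + 1)) * (1/2) / (real n + 1/2)"
    unfolding norm_divide norm_mult norm_of_nat
    using Suc norm_of_nat_plus_ge[OF Suc, of n] by (intro frac_le mult_left_mono mult_nonneg_nonneg) auto
  also have "\<dots> \<le> real n / 2 + 1/4"
    by (simp add: divide_simps) (simp add: algebra_simps)
  finally have "norm (2 * (z - 1) + of_nat (n * (n + 1)) * ?b / (of_nat (n + 1) + ?b)) \<le> 3/4 + (real n / 2 + 1/4)"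
  proof (rule norm_triangle_mono[rotated])
    show "norm (2 * (z - 1)) \<le> 3/4"
      using assms by (subst norm_mult) simp
  qed
  then have "norm (2 * (z - 1) + of_nat (n * (n + 1)) * ?b / (of_nat (n + 1) + ?b)) / real (n + 3) \<le> 1/2"
    by (simp add: divide_simps)
  then show ?case
    by (simp only: ratio_excess.simps norm_divide norm_of_nat)
qed (use assms in simp)

lemma vertex_gf_Suc:
  fixes z :: "'a::real_normed_field"
  assumes z: "norm (z - 1) \<le> 3/8"
  shows "vertex_gf z (Suc n) = vertex_gf z n * (1 + ratio_excess z n / of_nat (n + 1))"
proof (induction n)
  case 0
  show ?case by (subst vertex_gf.simps) simp
next
  case (Suc n)
  let ?b = "ratio_excess z n" and ?N = "of_nat (n + 1) :: 'a"
  have N: "?N \<noteq> 0" unfolding of_nat_eq_0_iff by simp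
  have D: "?N + ?b \<noteq> 0"
    using norm_of_nat_plus_ge[OF norm_ratio_excess_le[OF z], of n n] by force
  have n2: "(of_nat (n + 2) :: 'a) \<noteq> 0" "(of_nat (n + 3) :: 'a) \<noteq> 0"
    unfolding of_nat_eq_0_iff by auto
  \<comment> \<open>\<open>1 - d\<close> is the inverse of the factor that leads from \<open>g\<^sub>n\<close> to \<open>g\<^sub>n\<^sub>+\<^sub>1\<close>\<close>
  define d where "d = ?b / (?N + ?b)"
  have g: "vertex_gf z n = vertex_gf z (n + 1) * (1 - d)"
  proof -
    have "vertex_gf z (n + 1) = vertex_gf z n * ((?N + ?b) / ?N)"
    proof -
      have "(?N + ?b) / ?N = 1 + ?b / ?N"
        using N by (simp add: add_divide_distrib del: of_nat_add)
      then show ?thesis using Suc by (simp only: Suc_eq_plus1)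
    qed
    moreover have "1 - d = ?N / (?N + ?b)"
      using D unfolding d_def by (simp add: divide_simps del: of_nat_add)
    ultimately show ?thesis using D N by simp
  qed
  have b': "of_nat (n + 3) * ratio_excess z (Suc n) = 2 * (z - 1) + of_nat (n * (n + 1)) * d"
    using n2 by (simp only: ratio_excess.simps d_def) (simp del: of_nat_add of_nat_mult)
  have "of_nat ((n + 2) * (n + 3)) * vertex_gf z (n + 2) =
      (of_nat (2 * (n + 1) * (n + 2)) + 2 * z - of_nat (n * (n + 1)) * (1 - d)) * vertex_gf z (n + 1)"
    unfolding vertex_gf_three_term by (subst g) (simp only: algebra_simps)
  also have "of_nat (2 * (n + 1) * (n + 2)) + 2 * z - of_nat (n * (n + 1)) * (1 - d) =
      of_nat ((n + 2) * (n + 3)) + (2 * (z - 1) + of_nat (n * (n + 1)) * d)"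
    by (simp add: algebra_simps)
  also have "\<dots> = of_nat ((n + 2) * (n + 3)) * (1 + ratio_excess z (Suc n) / of_nat (n + 2))"
  proof -
    have "A * B + B * c = A * B * (1 + c / A)" if "A \<noteq> 0" for A B c :: 'a
      using that by (simp add: field_simps)
    from this[OF n2(1)] show ?thesis
      unfolding b'[symmetric] unfolding of_nat_mult .
  qed
  finally have "of_nat ((n + 2) * (n + 3)) * vertex_gf z (n + 2) = of_nat ((n + 2) * (n + 3)) *
      (vertex_gf z (n + 1) * (1 + ratio_excess z (Suc n) / of_nat (n + 2)))"
    by (simp only: mult_ac)
  then have "vertex_gf z (n + 2) = vertex_gf z (n + 1) * (1 + ratio_excess z (Suc n) / of_nat (n + 2))"
    using n2 unfolding of_nat_mult by (simp del: of_nat_add ratio_excess.simps)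
  then show ?case
    by (simp del: of_nat_add ratio_excess.simps)
qed

lemma vertex_gf_prod:
  fixes z :: "'a::real_normed_field"
  assumes z: "norm (z - 1) \<le> 3/8"
  shows "vertex_gf z n = (\<Prod>k<n. 1 + ratio_excess z k / of_nat (k + 1))"
  by (induction n) (simp_all add: vertex_gf_Suc[OF z])

text \<open>
  Subtracting the fixed point \<open>\<gamma>\<close> from the recursion gives
  \<open>(n + 3) (b\<^sub>n\<^sub>+\<^sub>1 - \<gamma>) = (n - b\<^sub>n - \<gamma>) (b\<^sub>n - \<gamma>) + O(1/n)\<close>.  As \<open>|b\<^sub>n|\<close> and \<open>|\<gamma>|\<close> are at most \<open>1/2\<close>, the first
  factor on the right is at most \<open>n + 1\<close>, and the contraction yields the rate \<open>O(1/n)\<close>.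
\<close>

lemma ratio_excess_limit:
  fixes z \<gamma> :: "'a::real_normed_field"
  assumes z: "norm (z - 1) \<le> 3/8" and \<gamma>: "\<gamma>\<^sup>2 + 3 * \<gamma> = 2 * (z - 1)" "norm \<gamma> \<le> 1/2"
  shows "norm (ratio_excess z n - \<gamma>) \<le> 2 / real (n + 2)"
proof (induction n)
  case 0
  have "norm (z - 1 - \<gamma>) \<le> 3/8 + 1/2"
    by (rule norm_triangle_le_diff[OF add_mono[OF z \<gamma>(2)]])
  then show ?case by simp
next
  case (Suc n)
  let ?b = "ratio_excess z n" and ?N = "of_nat (n + 1) :: 'a"
  have b: "norm ?b \<le> 1/2" by (rule norm_ratio_excess_le[OF z])
  have D: "?N + ?b \<noteq> 0"
    using norm_of_nat_plus_ge[OF b, of n] by force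
  have n3: "(of_nat (n + 3) :: 'a) \<noteq> 0" unfolding of_nat_eq_0_iff by auto
  have "of_nat (n * (n + 1)) * ?b / (?N + ?b) = of_nat n * ?b - ?b\<^sup>2 + ?b\<^sup>2 * (1 + ?b) / (?N + ?b)"
    using D by (simp add: divide_simps power2_eq_square) (simp add: algebra_simps)
  then have "of_nat (n + 3) * ratio_excess z (Suc n) =
      2 * (z - 1) + (of_nat n * ?b - ?b\<^sup>2 + ?b\<^sup>2 * (1 + ?b) / (?N + ?b))"
    using n3 by (simp del: of_nat_add of_nat_mult)
  then have "of_nat (n + 3) * (ratio_excess z (Suc n) - \<gamma>) =
      (of_nat n - ?b - \<gamma>) * (?b - \<gamma>) + ?b\<^sup>2 * (1 + ?b) / (?N + ?b)"
    unfolding \<gamma>(1)[symmetric] by (simp add: algebra_simps power2_eq_square del: ratio_excess.simps)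
  then have "real (n + 3) * norm (ratio_excess z (Suc n) - \<gamma>) =
      norm ((of_nat n - ?b - \<gamma>) * (?b - \<gamma>) + ?b\<^sup>2 * (1 + ?b) / (?N + ?b))"
    by (metis norm_mult norm_of_nat)
  also have "\<dots> \<le> (real n + 1/2 + 1/2) * (2 / real (n + 2)) + (1/2)\<^sup>2 * (3/2) / (real n + 1/2)"
  proof (intro norm_triangle_mono)
    have "norm (of_nat n - ?b - \<gamma>) \<le> real n + 1/2 + 1/2"
      using b \<gamma> by (intro norm_triangle_le_diff add_mono) auto
    then show "norm ((of_nat n - ?b - \<gamma>) * (?b - \<gamma>)) \<le> (real n + 1/2 + 1/2) * (2 / real (n + 2))"
      unfolding norm_mult using Suc by (intro mult_mono) auto
    have "norm (1 + ?b) \<le> 3/2"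
      using norm_triangle_mono[of 1 1 ?b "1/2"] b by simp
    then show "norm (?b\<^sup>2 * (1 + ?b) / (?N + ?b)) \<le> (1/2)\<^sup>2 * (3/2) / (real n + 1/2)"
      unfolding norm_divide norm_mult norm_power using b norm_of_nat_plus_ge[OF b, of n]
      by (intro frac_le mult_mono power_mono) auto
  qed
  also have "\<dots> \<le> 2"
    by (simp add: divide_simps power2_eq_square) (simp add: algebra_simps)
  finally show ?case
    by (simp add: field_simps del: ratio_excess.simps)
qed

lemma sum_inverse_squares_le: "(\<Sum>k<n. 1 / (real (k + 1))\<^sup>2) \<le> 2"
proof -
  have "(\<Sum>k<Suc n. 1 / (real (k + 1))\<^sup>2) \<le> 2 - 1 / real (Suc n)" for n
  proof (induction n)
    case (Suc n)
    have "1 / (real (Suc n + 1))\<^sup>2 \<le> 1 / real (Suc n) - 1 / real (Suc (Suc n))"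
      by (simp add: divide_simps power2_eq_square)
    with Suc show ?case by (subst sum.lessThan_Suc) linarith
  qed simp
  from this[of "n - 1"] show ?thesis
    by (cases n) (auto intro: order_trans)
qed

lemma harmonic_sum_near_ln:
  assumes "n \<ge> 1"
  shows "\<bar>(\<Sum>k<n. 1 / real (k + 1)) - ln (real n)\<bar> \<le> 1"
proof -
  have h: "(\<Sum>k<n. 1 / real (k + 1)) = harm n"
    by (simp add: harm_def sum.atLeast1_atMost_eq divide_inverse)
  have "ln (real n) \<le> ln (real n + 1)" using assms by simp
  then have "ln (real n) \<le> harm n" using ln_le_harm[of n] by linarith
  moreover have "harm (Suc (n - 1)) - ln (real (Suc (n - 1))) \<le> harm (Suc 0) - ln (real (Suc 0))"
    using decseqD[OF decseq_harm_diff_ln, of 0 "n - 1"] by simp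
  then have "harm n - ln (real n) \<le> 1"
    using assms by (simp add: harm_def)
  ultimately show ?thesis unfolding h by auto
qed

text \<open>
  A holomorphic logarithm of \<open>g\<^sub>n\<close>, built from the factors because each of them is within distance \<open>1/2\<close> of 1.
\<close>

definition log_vertex_gf :: "nat \<Rightarrow> complex \<Rightarrow> complex" where
  "log_vertex_gf n z = (\<Sum>k<n. Ln (1 + ratio_excess z k / of_nat (k + 1)))"

lemma norm_ratio_excess_div_le:
  fixes z :: "'a::real_normed_field"
  assumes "norm (z - 1) \<le> 3/8"
  shows "norm (ratio_excess z k / of_nat (k + 1)) \<le> 1 / (2 * real (k + 1))"
  using norm_ratio_excess_le[OF assms, of k]
    divide_right_mono[of "norm (ratio_excess z k)" "1/2" "real (k + 1)"]
  unfolding norm_divide norm_of_nat by simp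

text \<open>
  Each logarithm is \<open>\<gamma> / (k + 1)\<close> up to an error \<open>O(1/k\<^sup>2)\<close>: the quadratic error of the logarithm, and
  \<open>1 / (k + 1)\<close> times the distance of \<open>b\<^sub>k\<close> to its limit.  The bound does not depend on \<open>n\<close> or \<open>z\<close>.
\<close>

lemma log_vertex_gf_near:
  fixes z \<gamma> :: complex
  assumes z: "norm (z - 1) \<le> 3/8" and \<gamma>: "\<gamma>\<^sup>2 + 3 * \<gamma> = 2 * (z - 1)" "norm \<gamma> \<le> 1/2" and n: "n \<ge> 1"
  shows "norm (log_vertex_gf n z - of_real (ln (real n)) * \<gamma>) \<le> 6"
proof -
  have each: "norm (Ln (1 + ratio_excess z k / of_nat (k + 1)) - \<gamma> / of_nat (k + 1)) \<le> (5/2) * (1 / (real (k + 1))\<^sup>2)" for k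
  proof -
    define u where "u = ratio_excess z k / of_nat (k + 1)"
    have u: "norm u \<le> 1 / (2 * real (k + 1))"
      unfolding u_def by (rule norm_ratio_excess_div_le[OF z])
    also have "\<dots> \<le> 1/2" by (simp add: divide_simps)
    finally have u2: "norm u \<le> 1/2" .
    have "norm (Ln (1 + u) - u) \<le> (norm u)\<^sup>2 / (1 - norm u)"
      using u2 by (intro Ln_approx_linear) auto
    also have "\<dots> \<le> (1 / (2 * real (k + 1)))\<^sup>2 / (1/2)"
      using u u2 by (intro frac_le power_mono) auto
    also have "(1 / (2 * N))\<^sup>2 / (1/2) = (1/2) * (1 / N\<^sup>2)" for N :: real
      by (simp add: power2_eq_square)
    finally have 1: "norm (Ln (1 + u) - u) \<le> (1/2) * (1 / (real (k + 1))\<^sup>2)" .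
    have "norm (u - \<gamma> / of_nat (k + 1)) = norm (ratio_excess z k - \<gamma>) / real (k + 1)"
      unfolding u_def diff_divide_distrib[symmetric] norm_divide norm_of_nat ..
    also have "\<dots> \<le> (2 / real (k + 1)) / real (k + 1)"
      using order_trans[OF ratio_excess_limit[OF z \<gamma>, of k], of "2 / real (k + 1)"]
      by (intro divide_right_mono) (auto simp: divide_simps)
    finally have 2: "norm (u - \<gamma> / of_nat (k + 1)) \<le> 2 * (1 / (real (k + 1))\<^sup>2)"
      by (simp add: power2_eq_square)
    have "norm ((Ln (1 + u) - u) + (u - \<gamma> / of_nat (k + 1))) \<le> (1/2) * (1 / (real (k + 1))\<^sup>2) + 2 * (1 / (real (k + 1))\<^sup>2)"
      by (rule norm_triangle_mono[OF 1 2])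
    then show ?thesis unfolding u_def[symmetric] by simp
  qed
  have "norm (log_vertex_gf n z - (\<Sum>k<n. \<gamma> / of_nat (k + 1))) \<le> (\<Sum>k<n. (5/2) * (1 / (real (k + 1))\<^sup>2))"
    unfolding log_vertex_gf_def sum_subtractf[symmetric] by (intro sum_norm_le each)
  also have "\<dots> \<le> 5"
    unfolding sum_distrib_left[symmetric] using sum_inverse_squares_le[of n] by simp
  finally have 1: "norm (log_vertex_gf n z - (\<Sum>k<n. \<gamma> / of_nat (k + 1))) \<le> 5" .
  have "(\<Sum>k<n. \<gamma> / of_nat (k + 1)) - of_real (ln (real n)) * \<gamma> = \<gamma> * of_real ((\<Sum>k<n. 1 / real (k + 1)) - ln (real n))"
    by (simp add: algebra_simps sum_distrib_left)
  then have "norm ((\<Sum>k<n. \<gamma> / of_nat (k + 1)) - of_real (ln (real n)) * \<gamma>) = norm \<gamma> * \<bar>(\<Sum>k<n. 1 / real (k + 1)) - ln (real n)\<bar>"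
    by (simp only: norm_mult norm_of_real)
  also have "\<dots> \<le> 1 * 1"
    using \<gamma> harmonic_sum_near_ln[OF n] by (intro mult_mono) auto
  finally have "norm ((log_vertex_gf n z - (\<Sum>k<n. \<gamma> / of_nat (k + 1))) +
      ((\<Sum>k<n. \<gamma> / of_nat (k + 1)) - of_real (ln (real n)) * \<gamma>)) \<le> 5 + 1"
    by (intro norm_triangle_mono[OF 1]) auto
  then show ?thesis by simp
qed

lemma ratio_excess_of_real: "ratio_excess (of_real x) n = (of_real (ratio_excess x n) :: complex)"
  by (induction n) simp_all

lemma one_plus_ratio_excess_pos:
  assumes "\<bar>x - 1\<bar> \<le> 3/8"
  shows "1 + ratio_excess x k / real (k + 1) > 0"
proof -
  have "\<bar>ratio_excess x k / real (k + 1)\<bar> \<le> 1 / (2 * real (k + 1))"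
    using norm_ratio_excess_div_le[of x k] assms by simp
  also have "\<dots> \<le> 1/2" by (simp add: divide_simps)
  finally show ?thesis by linarith
qed

lemma vertex_gf_pos: "\<bar>x - 1\<bar> \<le> 3/8 \<Longrightarrow> vertex_gf x n > (0::real)"
  using one_plus_ratio_excess_pos[of x] by (subst vertex_gf_prod) (simp, intro prod_pos, blast)

lemma log_vertex_gf_of_real:
  assumes x: "\<bar>x - 1\<bar> \<le> 3/8"
  shows "log_vertex_gf n (of_real x) = of_real (ln (vertex_gf x n))"
proof -
  have "log_vertex_gf n (of_real x) = (\<Sum>k<n. of_real (ln (1 + ratio_excess x k / real (k + 1))))"
    unfolding log_vertex_gf_def
  proof (intro sum.cong refl)
    fix k
    have "1 + ratio_excess (of_real x) k / of_nat (k + 1) = complex_of_real (1 + ratio_excess x k / real (k + 1))"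
      by (simp add: ratio_excess_of_real)
    then show "Ln (1 + ratio_excess (of_real x) k / of_nat (k + 1)) = of_real (ln (1 + ratio_excess x k / real (k + 1)))"
      using one_plus_ratio_excess_pos[OF x, of k] by (simp only: Ln_of_real)
  qed
  also have "\<dots> = of_real (ln (\<Prod>k<n. 1 + ratio_excess x k / real (k + 1)))"
  proof -
    have pos: "1 + ratio_excess x k / real (k + 1) > 0" "1 + ratio_excess x k / real (k + 1) \<noteq> 0" for k
      using one_plus_ratio_excess_pos[OF x, of k] by linarith+
    have "ln (\<Prod>k<n. 1 + ratio_excess x k / real (k + 1)) = (\<Sum>k<n. ln (1 + ratio_excess x k / real (k + 1)))"
      by (rule ln_prod) (simp_all only: finite_lessThan pos simp_thms)
    then show ?thesis by (simp only: of_real_sum)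
  qed
  also have "(\<Prod>k<n. 1 + ratio_excess x k / real (k + 1)) = vertex_gf x n"
    using x by (subst vertex_gf_prod) auto
  finally show ?thesis .
qed

lemma holomorphic_ratio_excess:
  assumes f: "f holomorphic_on S" and b: "\<And>t. t \<in> S \<Longrightarrow> norm (f t - 1) \<le> 3/8"
  shows "(\<lambda>t. ratio_excess (f t) n) holomorphic_on S"
proof (induction n)
  case (Suc n)
  have "of_nat (n + 1) + ratio_excess (f t) n \<noteq> 0" if "t \<in> S" for t
    using norm_of_nat_plus_ge[OF norm_ratio_excess_le[OF b[OF that]], of n n] by force
  moreover have "complex_of_nat (n + 3) \<noteq> 0"
    unfolding of_nat_eq_0_iff by simp
  ultimately show ?case
    unfolding ratio_excess.simps using Suc f
    by - (intro holomorphic_intros; blast)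
qed (use f in \<open>auto intro!: holomorphic_intros\<close>)

lemma holomorphic_log_vertex_gf:
  assumes f: "f holomorphic_on S" and b: "\<And>t. t \<in> S \<Longrightarrow> norm (f t - 1) \<le> 3/8"
  shows "(\<lambda>t. log_vertex_gf n (f t)) holomorphic_on S"
  unfolding log_vertex_gf_def
proof (intro holomorphic_intros holomorphic_ratio_excess f b)
  fix k t assume "t \<in> S"
  let ?u = "ratio_excess (f t) k / of_nat (k + 1)"
  have "norm ?u \<le> 1 / (2 * real (k + 1))"
    by (rule norm_ratio_excess_div_le[OF b[OF \<open>t \<in> S\<close>]])
  also have "\<dots> \<le> 1/2" by (simp add: divide_simps)
  finally have "\<bar>Re ?u\<bar> \<le> 1/2" using abs_Re_le_cmod order_trans by blast
  then have "Re (1 + ?u) > 0" by (simp only: plus_complex.sel one_complex.sel)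
  then show "1 + ?u \<notin> \<real>\<^sub>\<le>\<^sub>0"
    by (metis complex_nonpos_Reals_iff not_less)
qed (unfold of_nat_eq_0_iff, auto)

section \<open>Derivatives of the growth exponent\<close>

definition growth_exponent :: "complex \<Rightarrow> complex" where
  "growth_exponent t = (csqrt (1 + 8 * exp t) - 3) / 2"

lemma Re_exp_near_1:
  assumes "norm (exp t - 1) \<le> 3/8"
  shows "Re (1 + 8 * exp t) > 0"
proof -
  have "\<bar>Re (exp t - 1)\<bar> \<le> 3/8"
    using assms abs_Re_le_cmod order_trans by blast
  then have "\<bar>Re (exp t) - 1\<bar> \<le> 3/8" by simp
  then have "Re (exp t) > 0" by linarith
  then show ?thesis by simp
qed

lemma growth_exponent_equation: "(growth_exponent t)\<^sup>2 + 3 * growth_exponent t = 2 * (exp t - 1)"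
proof -
  have "4 * ((growth_exponent t)\<^sup>2 + 3 * growth_exponent t) = (csqrt (1 + 8 * exp t))\<^sup>2 - 9"
    by (simp add: growth_exponent_def power2_eq_square field_simps del: csqrt.simps)
  also have "\<dots> = 4 * (2 * (exp t - 1))"
    by simp
  finally show ?thesis
    by (simp only: mult_cancel_left) simp
qed

text \<open>
  The product of the two roots of \<open>x\<^sup>2 + 3 x = 2 (exp t - 1)\<close> is at most \<open>3/4\<close> in norm, and the principal square root has nonnegative real
  part, which keeps the other root at distance at least \<open>3/2\<close> from 0.
\<close>

lemma norm_growth_exponent_le:
  assumes "norm (exp t - 1) \<le> 3/8"
  shows "norm (growth_exponent t) \<le> 1/2"
proof -
  let ?g = "growth_exponent t"
  have "Re (csqrt (1 + 8 * exp t)) \<ge> 0" by (rule Re_csqrt)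
  moreover have "?g + 3 = csqrt (1 + 8 * exp t) / 2 + of_real (3/2)"
    by (simp add: growth_exponent_def field_simps del: csqrt.simps)
  ultimately have "Re (?g + 3) \<ge> 3/2"
    by (simp del: csqrt.simps)
  then have g3: "norm (?g + 3) \<ge> 3/2"
    using complex_Re_le_cmod order_trans by blast
  have "?g * (?g + 3) = 2 * (exp t - 1)"
    using growth_exponent_equation[of t] by (simp add: power2_eq_square algebra_simps)
  then have "norm ?g * norm (?g + 3) = 2 * norm (exp t - 1)"
    by (metis norm_mult norm_numeral)
  then have "norm ?g * (3/2) \<le> 3/4"
    using mult_left_mono[OF g3, of "norm ?g"] assms by simp
  then show ?thesis by simp
qed

lemma csqrt_exp_derivative:
  assumes "norm (exp t - 1) \<le> 3/8"
  shows "((\<lambda>t. csqrt (1 + 8 * exp t)) has_field_derivative 4 * exp t / csqrt (1 + 8 * exp t)) (at t)"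
proof -
  have "1 + 8 * exp t \<notin> \<real>\<^sub>\<le>\<^sub>0"
    using Re_exp_near_1[OF assms] by (metis complex_nonpos_Reals_iff not_less)
  then show ?thesis
    by (auto intro!: derivative_eq_intros)
qed

text \<open>
  With \<open>S = sqrt (1 + 8 exp t)\<close>, the derivative of \<open>S\<close> is \<open>4 exp t / S\<close>.  These are the coefficients produced by
  differentiating the powers of \<open>S\<close> in turn, starting from the exponent \<open>(S - 3) / 2\<close> itself.
\<close>

fun exponent_coeff :: "nat \<Rightarrow> complex" where
  "exponent_coeff 0 = 0"
| "exponent_coeff (Suc 0) = 2"
| "exponent_coeff (Suc (Suc k)) = - 4 * of_nat (2 * k + 1) * exponent_coeff (Suc k)"

text \<open>
  The terms \<open>a\<^sub>k exp (k t) / S\<^sup>2\<^sup>k\<^sup>-\<^sup>1\<close> are \<open>exp (k t)\<close> times the \<open>k\<close>-th derivative of the exponent as a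
  function of \<open>exp t\<close>.
\<close>

definition exponent_term :: "nat \<Rightarrow> complex \<Rightarrow> complex" where
  "exponent_term k t = (if k = 0 then growth_exponent t
     else exponent_coeff k * exp (of_nat k * t) / csqrt (1 + 8 * exp t) ^ (2 * k - 1))"

text \<open>
  With \<open>z = exp t\<close>, this is the product rule for \<open>z\<^sup>k\<close> times a \<open>k\<close>-th derivative in \<open>z\<close>.
\<close>

lemma exponent_term_derivative:
  assumes t: "norm (exp t - 1) \<le> 3/8"
  shows "(exponent_term k has_field_derivative of_nat k * exponent_term k t + exponent_term (Suc k) t) (at t)"
proof -
  let ?S = "\<lambda>t. csqrt (1 + 8 * exp t)"
  have S0: "?S t \<noteq> 0"
  proof -
    have "1 + 8 * exp t \<noteq> 0"
      using Re_exp_near_1[OF t] by (metis less_irrefl zero_complex.sel(1))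
    then show ?thesis by simp
  qed
  note S' = csqrt_exp_derivative[OF t]
  show ?thesis
  proof (cases k)
    case 0
    have "((\<lambda>t. (?S t - 3) / 2) has_field_derivative (4 * exp t / ?S t - 0) / 2) (at t)"
      by (intro DERIV_cdivide DERIV_diff S' DERIV_const)
    moreover have "exponent_term 0 = (\<lambda>t. (?S t - 3) / 2)"
      by (simp add: fun_eq_iff exponent_term_def growth_exponent_def del: csqrt.simps)
    moreover have "exponent_term (Suc 0) t = 2 * exp t / ?S t"
      by (simp add: exponent_term_def del: csqrt.simps)
    ultimately show ?thesis
      by (simp add: 0 del: csqrt.simps)
  next
    case (Suc j)
    have pw: "((\<lambda>t. ?S t ^ (2 * j + 1)) has_field_derivative of_nat (2 * j + 1) * ?S t ^ (2 * j) * (4 * exp t / ?S t)) (at t)"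
      using DERIV_power[OF S', of "2 * j + 1"] by (simp add: mult_ac)
    have e: "((\<lambda>t. exponent_coeff k * exp (of_nat k * t)) has_field_derivative
        exponent_coeff k * (exp (of_nat k * t) * of_nat k)) (at t)"
      by (auto intro!: derivative_eq_intros)
    have "((\<lambda>t. exponent_coeff k * exp (of_nat k * t) / ?S t ^ (2 * j + 1)) has_field_derivative
        (exponent_coeff k * (exp (of_nat k * t) * of_nat k) * ?S t ^ (2 * j + 1) -
         exponent_coeff k * exp (of_nat k * t) * (of_nat (2 * j + 1) * ?S t ^ (2 * j) * (4 * exp t / ?S t))) /
        (?S t ^ (2 * j + 1) * ?S t ^ (2 * j + 1))) (at t)"
      using S0 by (intro DERIV_divide e pw) simp
    moreover have "(exponent_coeff k * (exp (of_nat k * t) * of_nat k) * ?S t ^ (2 * j + 1) -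
         exponent_coeff k * exp (of_nat k * t) * (of_nat (2 * j + 1) * ?S t ^ (2 * j) * (4 * exp t / ?S t))) /
        (?S t ^ (2 * j + 1) * ?S t ^ (2 * j + 1)) =
      of_nat k * exponent_term k t + exponent_term (Suc k) t"
    proof -
      define E where "E = exp (of_nat k * t)"
      define s where "s = ?S t"
      have s: "s \<noteq> 0" using S0 by (simp add: s_def)
      have E: "exp (of_nat (Suc k) * t) = E * exp t"
        by (simp add: E_def exp_add[symmetric] algebra_simps)
      have 1: "exponent_term k t = exponent_coeff k * E / s ^ (2 * j + 1)"
        by (simp add: exponent_term_def E_def s_def Suc)
      have 2: "exponent_term (Suc k) t = - 4 * of_nat (2 * j + 1) * exponent_coeff k * (E * exp t) / s ^ (2 * j + 3)"
        using E by (simp add: exponent_term_def s_def Suc numeral_3_eq_3)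
      have alg: "(c * (E * n) * P - c * E * (m * (P / s) * (4 * x / s))) / (P * P) =
          n * (c * E / P) + - 4 * m * c * (E * x) / (P * s\<^sup>2)" if "P \<noteq> 0" for c n m x P
        using that s by (simp add: field_simps power2_eq_square)
      have "s ^ (2 * j) = s ^ (2 * j + 1) / s" "s ^ (2 * j + 3) = s ^ (2 * j + 1) * s\<^sup>2"
      proof -
        show "s ^ (2 * j) = s ^ (2 * j + 1) / s" using s by simp
        have "2 * j + 3 = (2 * j + 1) + 2" by simp
        then show "s ^ (2 * j + 3) = s ^ (2 * j + 1) * s\<^sup>2" by (metis power_add)
      qed
      then have "(exponent_coeff k * (E * of_nat k) * s ^ (2 * j + 1) -
         exponent_coeff k * E * (of_nat (2 * j + 1) * s ^ (2 * j) * (4 * exp t / s))) /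
        (s ^ (2 * j + 1) * s ^ (2 * j + 1)) =
        of_nat k * (exponent_coeff k * E / s ^ (2 * j + 1)) +
        - 4 * of_nat (2 * j + 1) * exponent_coeff k * (E * exp t) / s ^ (2 * j + 3)"
        using alg[of "s ^ (2 * j + 1)"] s by (simp only: power_not_zero simp_thms)
      then show ?thesis
        unfolding 1 2 E_def s_def .
    qed
    ultimately show ?thesis
      by (simp add: exponent_term_def[abs_def] Suc)
  qed
qed

text \<open>
  Differentiating a term reproduces it with factor \<open>k\<close> and adds the next one; this is the recursion of the Stirling
  numbers of the second kind.
\<close>

lemma higher_deriv_growth_exponent:
  assumes "open S" and S: "\<And>t. t \<in> S \<Longrightarrow> norm (exp t - 1) \<le> 3/8" and "t \<in> S"
  shows "(deriv ^^ r) growth_exponent t = (\<Sum>k\<le>r. of_nat (Stirling r k) * exponent_term k t)"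
  using \<open>t \<in> S\<close>
proof (induction r arbitrary: t)
  case 0
  then show ?case by (simp add: exponent_term_def)
next
  case (Suc r)
  let ?T = exponent_term
  have D: "((\<lambda>t. \<Sum>k\<le>r. of_nat (Stirling r k) * ?T k t) has_field_derivative
      (\<Sum>k\<le>r. of_nat (Stirling r k) * (of_nat k * ?T k t + ?T (Suc k) t))) (at t)"
    by (intro DERIV_sum DERIV_cmult exponent_term_derivative S Suc.prems)
  have ev: "\<forall>\<^sub>F s in nhds t. (deriv ^^ r) growth_exponent s = (\<Sum>k\<le>r. of_nat (Stirling r k) * ?T k s)"
    using eventually_nhds_in_open[OF \<open>open S\<close> Suc.prems] by eventually_elim (rule Suc.IH)
  have "deriv ((deriv ^^ r) growth_exponent) t = deriv (\<lambda>t. \<Sum>k\<le>r. of_nat (Stirling r k) * ?T k t) t"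
    by (rule deriv_cong_ev[OF ev refl])
  also have "\<dots> = (\<Sum>k\<le>r. of_nat (Stirling r k) * (of_nat k * ?T k t + ?T (Suc k) t))"
    by (rule DERIV_imp_deriv[OF D])
  also have "\<dots> = (\<Sum>k\<le>Suc r. of_nat (k * Stirling r k) * ?T k t) + (\<Sum>k\<le>r. of_nat (Stirling r k) * ?T (Suc k) t)"
    by (simp add: sum.distrib[symmetric] algebra_simps)
  also have "(\<Sum>k\<le>Suc r. of_nat (k * Stirling r k) * ?T k t) = (\<Sum>k\<le>r. of_nat (Suc k * Stirling r (Suc k)) * ?T (Suc k) t)"
    by (subst sum.atMost_Suc_shift) simp
  also have "\<dots> + (\<Sum>k\<le>r. of_nat (Stirling r k) * ?T (Suc k) t) =
      (\<Sum>k\<le>r. of_nat (Stirling (Suc r) (Suc k)) * ?T (Suc k) t)"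
    unfolding sum.distrib[symmetric] by (intro sum.cong refl) (simp add: algebra_simps)
  also have "\<dots> = (\<Sum>k\<le>Suc r. of_nat (Stirling (Suc r) k) * ?T k t)"
    by (subst sum.atMost_Suc_shift) simp
  finally show ?case by simp
qed

lemma exponent_coeff_eq:
  "exponent_coeff (Suc k) = (- 1) ^ k * 2 ^ Suc k * fact (2 * k) / fact k"
proof (induction k)
  case (Suc k)
  have "fact (2 * Suc k) = (of_nat (2 * k + 2) * of_nat (2 * k + 1) * fact (2 * k) :: complex)"
    by (simp add: mult_ac)
  also have "\<dots> = of_nat (Suc k) * (2 * of_nat (2 * k + 1) * fact (2 * k))"
    by (simp add: algebra_simps)
  finally have "fact (2 * Suc k) / fact (Suc k) = (of_nat (Suc k) * (2 * of_nat (2 * k + 1) * fact (2 * k))) /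
      (of_nat (Suc k) * fact k :: complex)"
    by (simp only: fact_Suc)
  also have "\<dots> = 2 * of_nat (2 * k + 1) * (fact (2 * k) / fact k)"
    by (subst mult_divide_mult_cancel_left) (simp_all del: of_nat_Suc)
  finally have "fact (2 * Suc k) / fact (Suc k) = 2 * of_nat (2 * k + 1) * (fact (2 * k) / fact k :: complex)" .
  moreover have "(- 1) ^ Suc k * 2 ^ Suc (Suc k) * (2 * m * F) = - 4 * m * ((- 1) ^ k * 2 ^ Suc k * F)"
    for m F :: complex
    by simp
  ultimately have "(- 1) ^ Suc k * 2 ^ Suc (Suc k) * (fact (2 * Suc k) / fact (Suc k)) =
      - 4 * of_nat (2 * k + 1) * ((- 1) ^ k * 2 ^ Suc k * (fact (2 * k) / fact k) :: complex)"
    by (simp only:)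
  then show ?case
    using Suc by (simp only: exponent_coeff.simps times_divide_eq_right)
qed simp

definition cumulant_constant :: "nat \<Rightarrow> real" where
  "cumulant_constant r = (\<Sum>k=1..r. (-1) ^ (k - 1) * real (Stirling r k) *
        (2 ^ k * fact (2 * k - 2)) / (3 ^ (2 * k - 1) * fact (k - 1)))"

lemma higher_deriv_growth_exponent_0:
  fixes S :: "complex set"
  assumes "open S" and "\<And>t. t \<in> S \<Longrightarrow> norm (exp t - 1) \<le> 3/8" and "0 \<in> S" and "r \<ge> 1"
  shows "(deriv ^^ r) growth_exponent 0 = of_real (cumulant_constant r)"
proof -
  have s3: "csqrt (1 + 8 * exp 0) = 3"
    using csqrt_of_real_nonneg[of 9] by simp
  have "(deriv ^^ r) growth_exponent 0 = (\<Sum>k\<le>r. of_nat (Stirling r k) * exponent_term k 0)"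
    using assms by (intro higher_deriv_growth_exponent) auto
  also have "\<dots> = (\<Sum>k=1..r. of_nat (Stirling r k) * exponent_term k 0)"
  proof (intro sum.mono_neutral_right ballI)
    fix k assume "k \<in> {..r} - {1..r}"
    then have "k = 0" by auto
    then show "of_nat (Stirling r k) * exponent_term k 0 = 0"
      using \<open>r \<ge> 1\<close> by (cases r) simp_all
  qed auto
  also have "\<dots> = (\<Sum>k=1..r. of_real ((-1) ^ (k - 1) * real (Stirling r k) *
        (2 ^ k * fact (2 * k - 2)) / (3 ^ (2 * k - 1) * fact (k - 1))))"
  proof (intro sum.cong refl)
    fix k assume "k \<in> {1..r}"
    then obtain j where k: "k = Suc j" by (cases k) auto
    show "of_nat (Stirling r k) * exponent_term k 0 = complex_of_real ((-1) ^ (k - 1) * real (Stirling r k) *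
        (2 ^ k * fact (2 * k - 2)) / (3 ^ (2 * k - 1) * fact (k - 1)))"
      unfolding exponent_term_def k exponent_coeff_eq s3 by (simp add: mult_ac)
  qed
  finally show ?thesis
    by (simp add: cumulant_constant_def)
qed

lemma power_dvd_fact_quotient: "\<exists>d::nat. fact (2 * k) = 2 ^ k * fact k * d"
proof (induction k)
  case (Suc k)
  then obtain d :: nat where d: "fact (2 * k) = 2 ^ k * fact k * d" by blast
  have "fact (2 * Suc k) = (2 * k + 2) * (2 * k + 1) * (fact (2 * k) :: nat)"
    by (simp add: algebra_simps)
  also have "\<dots> = 2 ^ Suc k * fact (Suc k) * ((2 * k + 1) * d)"
    unfolding d by (simp add: algebra_simps)
  finally show ?case by blast
qed simp

text \<open>
  Since \<open>(2 k - 2)! / (k - 1)!\<close> is divisible by \<open>2\<^sup>k\<^sup>-\<^sup>1\<close>, multiplication by \<open>3\<^sup>2\<^sup>r\<^sup>-\<^sup>1\<close> turns half of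
  the sum into a sum of integers in which the term for \<open>k = 1\<close> is odd and all others are even.
\<close>

lemma cumulant_constant_nonzero:
  assumes "r \<ge> 1"
  shows "cumulant_constant r \<noteq> 0"
proof
  assume 0: "cumulant_constant r = 0"
  obtain d :: "nat \<Rightarrow> nat" where d: "\<And>k. fact (2 * k) = 2 ^ k * fact k * d k"
    using power_dvd_fact_quotient by metis
  define f where "f k = (-1) ^ (k - 1) * int (Stirling r k) * 2 ^ (2 * k - 2) * int (d (k - 1)) * 3 ^ (2 * (r - k))" for k
  have "3 ^ (2 * r - 1) * cumulant_constant r = 2 * (\<Sum>k=1..r. real_of_int (f k))"
    unfolding cumulant_constant_def sum_distrib_left
  proof (intro sum.cong refl)
    fix k assume k: "k \<in> {1..r}"
    then obtain j where j: "k = Suc j" by (cases k) auto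
    have "(fact (2 * j) :: real) = of_nat (fact (2 * j))" by simp
    also have "\<dots> = 2 ^ j * fact j * real (d j)" unfolding d by simp
    finally have F: "(fact (2 * j) :: real) = 2 ^ j * fact j * real (d j)" .
    have "2 * r - 1 = (2 * k - 1) + 2 * (r - k)" using k by auto
    then have P: "(3::real) ^ (2 * r - 1) = 3 ^ (2 * k - 1) * 3 ^ (2 * (r - k))"
      by (metis power_add)
    show "3 ^ (2 * r - 1) * ((-1) ^ (k - 1) * real (Stirling r k) *
        (2 ^ k * fact (2 * k - 2)) / (3 ^ (2 * k - 1) * fact (k - 1))) = 2 * real_of_int (f k)"
    proof -
      have "A * Q * (\<sigma> * (2 ^ Suc j * (2 ^ j * b * e)) / (A * b)) = 2 * (\<sigma> * 2 ^ (2 * j) * e * Q)"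
        if "A \<noteq> 0" "b \<noteq> 0" for A Q \<sigma> b e :: real
      proof -
        have "(2::real) ^ (2 * j) = 2 ^ j * 2 ^ j"
          by (metis mult_2 power_add)
        then have a: "(2::real) ^ Suc j * (2 ^ j * b * e) = 2 * 2 ^ (2 * j) * b * e"
          by (simp only: power_Suc mult.assoc)
        have "A * Q * (\<sigma> * (2 * Z * b * e) / (A * b)) = 2 * (\<sigma> * Z * e * Q)" for Z
          using that by (simp add: field_simps)
        then show ?thesis unfolding a .
      qed
      from this[of "3 ^ (2 * k - 1)" "fact j" "3 ^ (2 * (r - k))" "(-1) ^ j * real (Stirling r k)" "real (d j)"]
      have "3 ^ (2 * k - 1) * 3 ^ (2 * (r - k)) * ((-1) ^ j * real (Stirling r k) *
          (2 ^ Suc j * fact (2 * j)) / (3 ^ (2 * k - 1) * fact j)) =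
        2 * ((-1) ^ j * real (Stirling r k) * 2 ^ (2 * j) * real (d j) * 3 ^ (2 * (r - k)))"
        unfolding F by simp
      moreover have "2 * k - 2 = 2 * j" "k - 1 = j" using j by auto
      ultimately show ?thesis
        unfolding P f_def by (simp only: j) simp
    qed
  qed
  then have "real_of_int (\<Sum>k=1..r. f k) = 0" using 0 by simp
  then have sum0: "(\<Sum>k=1..r. f k) = 0" by (simp only: of_int_eq_0_iff)
  have "(\<Sum>k=1..r. f k) = f 1 + (\<Sum>k=2..r. f k)"
    using assms by (simp add: sum.atLeast_Suc_atMost numeral_2_eq_2)
  moreover have "even (\<Sum>k=2..r. f k)"
    by (intro dvd_sum) (auto simp: f_def)
  moreover have "f 1 = 3 ^ (2 * (r - 1))"
  proof -
    have "d 0 = 1" using d[of 0] by simp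
    moreover have "Stirling r 1 = 1" using assms by (cases r) (simp_all del: Stirling.simps)
    ultimately show ?thesis by (simp add: f_def)
  qed
  ultimately have "odd (\<Sum>k=1..r. f k)" by simp
  then show False unfolding sum0 by simp
qed

section \<open>Cumulants\<close>

text \<open>
  Cumulants are real derivatives, Cauchy's inequality concerns complex ones; both agree when a holomorphic
  function extends the real one.
\<close>

lemma higher_deriv_of_real:
  fixes F :: "complex \<Rightarrow> complex" and f :: "real \<Rightarrow> real"
  assumes F: "F holomorphic_on S" "open S"
    and eq: "\<And>t. of_real t \<in> S \<Longrightarrow> F (of_real t) = of_real (f t)" and t: "of_real t \<in> S"
  shows "(deriv ^^ r) F (of_real t) = of_real ((deriv ^^ r) f t)"
  using t
proof (induction r arbitrary: t)
  case (Suc r)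
  let ?F = "(deriv ^^ r) F" and ?f = "(deriv ^^ r) f"
  define D where "D = deriv ?F (of_real t)"
  have "?F holomorphic_on S"
    by (rule holomorphic_higher_deriv[OF F])
  then have D: "(?F has_field_derivative D) (at (of_real t))"
    unfolding D_def using F(2) Suc.prems by (rule holomorphic_derivI)
  then have vec: "((\<lambda>s. ?F (of_real s)) has_vector_derivative D) (at t)"
    using has_vector_derivative_real_field by blast
  have "open (of_real -` S :: real set)"
    using F(2) by (intro open_vimage continuous_intros)
  with vec have "((\<lambda>s. of_real (?f s)) has_vector_derivative D) (at t)"
    by (rule has_vector_derivative_transform_within_open) (use Suc in auto)
  then have "((\<lambda>s. Re (of_real (?f s))) has_vector_derivative Re D) (at t)"
    "((\<lambda>s. Im (of_real (?f s))) has_vector_derivative Im D) (at t)"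
    by (auto intro: bounded_linear.has_vector_derivative[OF bounded_linear_Re]
        bounded_linear.has_vector_derivative[OF bounded_linear_Im] simp del: Re_complex_of_real Im_complex_of_real)
  then have "(?f has_real_derivative Re D) (at t)" "((\<lambda>_. 0) has_vector_derivative Im D) (at t)"
    by (simp_all add: has_real_derivative_iff_has_vector_derivative)
  then have "deriv ?f t = Re D" "Im D = 0"
    by (auto intro: DERIV_imp_deriv simp flip: has_real_derivative_iff_has_vector_derivative dest: DERIV_unique[OF DERIV_const])
  then show ?case
    by (simp add: D_def[symmetric] complex_eq_iff)
qed (use eq in simp)

text \<open>
  The holomorphic function \<open>2 t + log g\<^sub>n(exp t)\<close> extends the cumulant generating function; the summand \<open>2 t\<close> accounts
  for the two fixed vertices.  Its distance to \<open>log n\<close> times the growth exponent is bounded on a disc around 0,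
  and Cauchy's inequality passes this bound on to the derivatives at 0.
\<close>

lemma cumulant_near_ln:
  assumes "r \<ge> 1"
  obtains B where
    "\<And>n (M :: 'a measure) (X :: nat \<Rightarrow> 'a \<Rightarrow> real \<times> real). n \<ge> 1 \<Longrightarrow> prob_space M \<Longrightarrow> prob_space.indep_vars M (\<lambda>_. borel) X {1..n} \<Longrightarrow>
      (\<And>i. i \<in> {1..n} \<Longrightarrow> distr M borel (X i) = uniform_measure lborel unit_triangle) \<Longrightarrow>
      \<bar>cumulant r M (\<lambda>\<omega>. real (f0 (hull_polygon n (\<lambda>i. X i \<omega>)))) - cumulant_constant r * ln (real n)\<bar> \<le> B"
proof -
  have "isCont (exp :: complex \<Rightarrow> complex) 0" by simp
  then obtain \<rho>' where \<rho>': "\<rho>' > 0" "\<And>t :: complex. norm t < \<rho>' \<Longrightarrow> norm (exp t - 1) < 3/8"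
    unfolding continuous_at_eps_delta by (force simp: dist_norm dest: spec[of _ "3/8 :: real"])
  define \<rho> where "\<rho> = min \<rho>' 1"
  have \<rho>: "0 < \<rho>" "\<rho> \<le> 1" using \<rho>' by (auto simp: \<rho>_def)
  have small: "norm (exp t - 1) \<le> 3/8" if "t \<in> ball 0 \<rho>" for t :: complex
    using that \<rho>'(2)[of t] by (auto simp: \<rho>_def)
  let ?D = "ball (0 :: complex) \<rho>"
  have gr_hol: "growth_exponent holomorphic_on ?D"
  proof -
    have "(growth_exponent has_field_derivative exponent_term 1 t) (at t)" if "t \<in> ?D" for t
      using exponent_term_derivative[OF small[OF that], of 0] by (simp add: exponent_term_def[abs_def])
    then show ?thesis
      by (intro holomorphic_onI) (auto simp: field_differentiable_def intro: has_field_derivative_at_within)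
  qed
  define F where "F n t = 2 * t + log_vertex_gf n (exp t)" for n and t :: complex
  have F_hol: "F n holomorphic_on ?D" for n
    unfolding F_def[abs_def] by (intro holomorphic_intros holomorphic_log_vertex_gf small)
  \<comment> \<open>what remains after removing the logarithmic growth; it is bounded uniformly in \<open>n\<close>\<close>
  define G where "G n t = F n t - of_real (ln (real n)) * growth_exponent t" for n t
  have G_hol: "G n holomorphic_on ?D" for n
    unfolding G_def[abs_def] by (intro holomorphic_intros F_hol gr_hol)
  have G_bound: "norm (G n t) \<le> 8" if "n \<ge> 1" "t \<in> ?D" for n t
  proof -
    have "norm (log_vertex_gf n (exp t) - of_real (ln (real n)) * growth_exponent t) \<le> 6"
      using small[OF that(2)] that(1)
      by (intro log_vertex_gf_near growth_exponent_equation norm_growth_exponent_le)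
    moreover have "norm (2 * t) \<le> 2"
      using that(2) \<rho> by (simp add: norm_mult)
    ultimately have "norm (2 * t + (log_vertex_gf n (exp t) - of_real (ln (real n)) * growth_exponent t)) \<le> 2 + 6"
      by (intro norm_triangle_mono)
    then show ?thesis by (simp add: G_def F_def algebra_simps)
  qed
  define B where "B = fact r * 8 / (\<rho> / 2) ^ r"
  have derivs: "norm ((deriv ^^ r) (F n) 0 - of_real (cumulant_constant r * ln (real n))) \<le> B" if "n \<ge> 1" for n
  proof -
    have "norm ((deriv ^^ r) (G n) 0) \<le> B"
      unfolding B_def
    \<comment> \<open>half the radius, because \<open>G n\<close> is only known to be continuous inside the disc\<close>
    proof (rule Cauchy_inequality)
      have "G n holomorphic_on cball 0 (\<rho> / 2)"
        using \<rho> by (intro holomorphic_on_subset[OF G_hol]) auto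
      then show "continuous_on (cball 0 (\<rho> / 2)) (G n)" "G n holomorphic_on ball 0 (\<rho> / 2)"
        using holomorphic_on_imp_continuous_on holomorphic_on_subset ball_subset_cball by blast+
      show "norm (G n x) \<le> 8" if "norm (0 - x) = \<rho> / 2" for x
        using that \<open>n \<ge> 1\<close> \<rho> by (intro G_bound) auto
    qed (use \<rho> in auto)
    also have "(deriv ^^ r) (G n) 0 = (deriv ^^ r) (F n) 0 - of_real (ln (real n)) * (deriv ^^ r) growth_exponent 0"
      unfolding G_def[abs_def] using \<rho>
      by (subst higher_deriv_diff[OF F_hol _ open_ball])
        (auto intro!: holomorphic_intros gr_hol simp: higher_deriv_cmult[OF gr_hol _ open_ball])
    also have "(deriv ^^ r) growth_exponent 0 = of_real (cumulant_constant r)"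
      using \<rho> assms by (intro higher_deriv_growth_exponent_0[of ?D] small) auto
    finally show ?thesis by (simp add: mult.commute)
  qed
  show thesis
  proof (rule that[of B])
    fix n :: nat and M :: "'a measure" and X :: "nat \<Rightarrow> 'a \<Rightarrow> real \<times> real"
    assume n: "n \<ge> 1" and M: "prob_space M" "prob_space.indep_vars M (\<lambda>_. borel) X {1..n}"
      "\<And>i. i \<in> {1..n} \<Longrightarrow> distr M borel (X i) = uniform_measure lborel unit_triangle"
    let ?Y = "\<lambda>\<omega>. real (f0 (hull_polygon n (\<lambda>i. X i \<omega>)))"
    define f where "f t = ln (\<integral>\<omega>. exp (t * ?Y \<omega>) \<partial>M)" for t
    have eq: "F n (of_real t) = of_real (f t)" if t: "of_real t \<in> ?D" for t
    proof -
      have "norm (exp (of_real t) - 1 :: complex) = \<bar>exp t - 1\<bar>"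
        by (metis exp_of_real norm_of_real of_real_1 of_real_diff)
      then have x: "\<bar>exp t - 1\<bar> \<le> 3/8" using small[OF t] by simp
      have "(\<integral>\<omega>. exp (t * ?Y \<omega>) \<partial>M) = (\<integral>\<omega>. exp t ^ f0 (hull_polygon n (\<lambda>i. X i \<omega>)) \<partial>M)"
        by (simp add: exp_of_nat_mult[symmetric] mult.commute)
      also have "\<dots> = (exp t)\<^sup>2 * vertex_gf (exp t) n"
        using M n by (intro expectation_power_f0) auto
      finally have "f t = 2 * t + ln (vertex_gf (exp t) n)"
        unfolding f_def using vertex_gf_pos[OF x, of n] by (simp add: ln_mult ln_realpow)
      then show ?thesis
        unfolding F_def exp_of_real log_vertex_gf_of_real[OF x] by simp
    qed
    have "(deriv ^^ r) (F n) (of_real 0) = of_real ((deriv ^^ r) f 0)"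
      using \<rho> by (intro higher_deriv_of_real[OF F_hol open_ball eq]) auto
    then have "norm (of_real ((deriv ^^ r) f 0 - cumulant_constant r * ln (real n)) :: complex) \<le> B"
      using derivs[OF n] by simp
    then show "\<bar>cumulant r M ?Y - cumulant_constant r * ln (real n)\<bar> \<le> B"
      unfolding norm_of_real cumulant_def f_def[abs_def] .
  qed
qed

theorem corollary3p3:
  fixes M :: "nat \<Rightarrow> 'a measure"
    and X :: "nat \<Rightarrow> nat \<Rightarrow> 'a \<Rightarrow> real \<times> real"
    and r :: nat
  assumes prob: "\<And>n. prob_space (M n)"
    and indep: "\<And>n. prob_space.indep_vars (M n) (\<lambda>_. borel) (X n) {1..n}"
    and uniform: "\<And>n i. i \<in> {1..n} \<Longrightarrow>
      distr (M n) borel (X n i) = uniform_measure lborel unit_triangle"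
    and r: "r \<ge> 1"
  shows "(\<lambda>n. cumulant r (M n) (\<lambda>\<omega>. real (f0 (hull_polygon n (\<lambda>i. X n i \<omega>)))))
    \<sim>[sequentially]
    (\<lambda>n. (\<Sum>k=1..r. (-1) ^ (k - 1) * real (Stirling r k) *
        (2 ^ k * fact (2 * k - 2)) / (3 ^ (2 * k - 1) * fact (k - 1))) * ln (real n))"
proof -
  let ?K = "\<lambda>n. cumulant r (M n) (\<lambda>\<omega>. real (f0 (hull_polygon n (\<lambda>i. X n i \<omega>))))"
  define c where "c = cumulant_constant r"
  obtain B where B: "\<And>n. n \<ge> 1 \<Longrightarrow> \<bar>?K n - c * ln (real n)\<bar> \<le> B"
    using cumulant_near_ln[OF r, where 'a = 'a] prob indep uniform unfolding c_def by metis
  have "(\<lambda>n. ?K n - c * ln (real n)) \<in> O(\<lambda>_. 1)"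
    by (intro bigoI[of _ B] eventually_sequentiallyI[of 1]) (simp add: B)
  also have "(\<lambda>_. 1) \<in> o(\<lambda>n. ln (real n))"
    by real_asymp
  also have "(\<lambda>n. ln (real n)) \<in> O(\<lambda>n. c * ln (real n))"
    using cumulant_constant_nonzero[OF r] by (simp add: c_def)
  finally have "?K \<sim>[sequentially] (\<lambda>n. c * ln (real n))"
    by (simp add: asymp_equiv_altdef)
  then show ?thesis
    unfolding c_def cumulant_constant_def .
qed

end
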